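(* Let $a,b\ge1$ be integers and suppose that the maximal parabolic subalgebra $\mathfrak p(a,b)\subset\mathfrak{sl}_{a+b}$ is Frobenius. Then there exists a filling of its associated pyramid (respecting ranks) such that the corresponding good element $e$ lies in $\mathfrak p(a,b)$.
   Context: Work over $\mathbb C$; put $n=a+b$. $\mathfrak p(a,b)$ is the subalgebra of $\mathfrak{sl}_n$ of trace-zero matrices $X$ with $X_{i,j}=0$ for $i>a$, $j\le a$; it is Frobenius (the form $(x,y)\mapsto F([x,y])$ is non-degenerate for some $F\in\mathfrak p(a,b)^*$) if and only if $\gcd(a,b)=1$. Ranked meander. $M_{a,b}$ is the directed graph on $\{1,\dots,n\}$ with edges $i\to n+1-i$ for $1\le i<n+1-i$; edges $a+1-i\to i$ for $1\le i<a+1-i$; and edges $n+1-i\to a+i$ for $i\ge1$ with $a+i<n+1-i$. When $\gcd(a,b)=1$ its underlying undirected graph is a single path, and $\operatorname{rnk}$ denotes the unique integer-valued function on vertices with minimum value $0$ and $\operatorname{rnk}(k)=\operatorname{rnk}(\ell)+1$ for each edge $k\to\ell$. Let $m$ be the maximum rank and $c_t=\#\{i\in\{1,\dots,n\}:\operatorname{rnk}(i)=m-t\}$ for $0\le t\le m$. It is known that $(c_0,\dots,c_m)$ is a unimodal sequence of positive integers. Pyramid. The pyramid associated to $\mathfrak p(a,b)$ has columns $0,1,\dots,m$ from left to right, column $t$ consisting of boxes $(t,h)$ with $1\le h\le c_t$. Row $h$ consists of the boxes $(t,h)$ with $c_t\ge h$ (a contiguous set of columns, by unimodality). A filling respecting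 ranks is a bijective filling of the boxes with $1,\dots,n$ such that column $t$ contains exactly the integers $i$ with $\operatorname{rnk}(i)=m-t$. The corresponding good element is $e=\sum e_{i,j}\in\mathfrak{gl}_n$ (a sum of matrix units), over all pairs $(i,j)$ that are consecutive entries, read from left to right, in some row, i.e. $i$ is in box $(t,h)$ and $j$ is in box $(t+1,h)$ for some $t,h$. *)

theory Defs
  imports Complex_Main "HOL-Library.FuncSet" "Jordan_Normal_Form.Matrix"
begin

text \<open>
  Library matrices are indexed from 0, whereas vertices of the meander, entries of a filling and
  the indices of matrix units are numbered \<open>1, \<dots>, n\<close>.  Hence \<open>X\<^sub>i\<^sub>,\<^sub>j\<close> is \<open>X $$ (i - 1, j - 1)\<close>.
\<close>

section \<open>Maximal parabolic subalgebras and the Frobenius property\<close>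

definition mat_bracket :: "complex mat \<Rightarrow> complex mat \<Rightarrow> complex mat" where
  "mat_bracket X Y = X * Y - Y * X"

definition maximal_parabolic :: "nat \<Rightarrow> nat \<Rightarrow> complex mat set" where
  "maximal_parabolic a b =
     {X \<in> carrier_mat (a + b) (a + b).
        (\<Sum>i<a + b. X $$ (i, i)) = 0 \<and>
        (\<forall>i\<in>{1..a + b}. \<forall>j\<in>{1..a + b}. i > a \<and> j \<le> a \<longrightarrow> X $$ (i - 1, j - 1) = 0)}"

text \<open>Functionals are taken as total functions; only their values on \<open>\<gg>\<close> matter.\<close>

definition linear_functional_on :: "complex mat set \<Rightarrow> (complex mat \<Rightarrow> complex) \<Rightarrow> bool" where
  "linear_functional_on \<gg> F \<longleftrightarrow>
     (\<forall>X\<in>\<gg>. \<forall>Y\<in>\<gg>. F (X + Y) = F X + F Y) \<and>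
     (\<forall>c. \<forall>X\<in>\<gg>. F (c \<cdot>\<^sub>m X) = c * F X)"

text \<open>
  The form \<open>(X, Y) \<mapsto> F [X, Y]\<close> is alternating, so its left and right radicals coincide and it is
  enough to ask for the former to vanish.
\<close>

definition frobenius :: "nat \<Rightarrow> complex mat set \<Rightarrow> bool" where
  "frobenius n \<gg> \<longleftrightarrow>
     (\<exists>F. linear_functional_on \<gg> F \<and>
        (\<forall>X\<in>\<gg>. (\<forall>Y\<in>\<gg>. F (mat_bracket X Y) = 0) \<longrightarrow> X = 0\<^sub>m n n))"

section \<open>Ranked meanders\<close>

definition meander_edges :: "nat \<Rightarrow> nat \<Rightarrow> (nat \<times> nat) set" where
  "meander_edges a b =
     (let n = a + b in
        {(i, n + 1 - i) |i. 1 \<le> i \<and> i < n + 1 - i} \<union>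
        {(a + 1 - i, i) |i. 1 \<le> i \<and> i < a + 1 - i} \<union>
        {(n + 1 - i, a + i) |i. 1 \<le> i \<and> a + i < n + 1 - i})"

definition is_rank_function :: "nat \<Rightarrow> nat \<Rightarrow> (nat \<Rightarrow> int) \<Rightarrow> bool" where
  "is_rank_function a b r \<longleftrightarrow>
     r \<in> {1..a + b} \<rightarrow>\<^sub>E UNIV \<and>
     Min (r ` {1..a + b}) = 0 \<and>
     (\<forall>(k, l)\<in>meander_edges a b. r k = r l + 1)"

text \<open>
  Meaningful only if exactly one rank function exists, which is the case for coprime positive
  \<open>a\<close> and \<open>b\<close>.
\<close>

definition rnk :: "nat \<Rightarrow> nat \<Rightarrow> nat \<Rightarrow> int" where
  "rnk a b = (THE r. is_rank_function a b r)"

definition max_rnk :: "nat \<Rightarrow> nat \<Rightarrow> nat" where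
  "max_rnk a b = nat (Max (rnk a b ` {1..a + b}))"

section \<open>Pyramids, fillings and good elements\<close>

definition column_entries :: "nat \<Rightarrow> nat \<Rightarrow> nat \<Rightarrow> nat set" where
  "column_entries a b t = {i \<in> {1..a + b}. rnk a b i = int (max_rnk a b) - int t}"

definition column_height :: "nat \<Rightarrow> nat \<Rightarrow> nat \<Rightarrow> nat" where
  "column_height a b t = card (column_entries a b t)"

text \<open>A box is a pair \<open>(t, h)\<close> of a column and a row index.\<close>

definition pyramid :: "nat \<Rightarrow> nat \<Rightarrow> (nat \<times> nat) set" where
  "pyramid a b = {(t, h). t \<le> max_rnk a b \<and> 1 \<le> h \<and> h \<le> column_height a b t}"

definition filling_respecting_ranks :: "nat \<Rightarrow> nat \<Rightarrow> (nat \<times> nat \<Rightarrow> nat) \<Rightarrow> bool" where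
  "filling_respecting_ranks a b f \<longleftrightarrow>
     bij_betw f (pyramid a b) {1..a + b} \<and>
     (\<forall>t\<le>max_rnk a b. f ` {(s, h) \<in> pyramid a b. s = t} = column_entries a b t)"

definition consecutive_entries :: "nat \<Rightarrow> nat \<Rightarrow> (nat \<times> nat \<Rightarrow> nat) \<Rightarrow> (nat \<times> nat) set" where
  "consecutive_entries a b f =
     {(f (t, h), f (t + 1, h)) |t h. (t, h) \<in> pyramid a b \<and> (t + 1, h) \<in> pyramid a b}"

definition matrix_unit :: "nat \<Rightarrow> nat \<Rightarrow> nat \<Rightarrow> complex mat" where
  "matrix_unit n i j = mat n n (\<lambda>(r, s). if r = i - 1 \<and> s = j - 1 then 1 else 0)"

text \<open>Square matrices of unspecified size form no additive monoid, so the sum is taken entrywise.\<close>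

definition good_element :: "nat \<Rightarrow> nat \<Rightarrow> (nat \<times> nat \<Rightarrow> nat) \<Rightarrow> complex mat" where
  "good_element a b f =
     mat (a + b) (a + b)
       (\<lambda>(r, s). \<Sum>(i, j)\<in>consecutive_entries a b f. matrix_unit (a + b) i j $$ (r, s))"

end

theory Submission
  imports Defs "Jordan_Normal_Form.Determinant"
begin

text \<open>
  Call an entry large if it exceeds \<open>a\<close>.  The good element lies in the parabolic iff no large entry
  is directly followed by a small one in a row, so only the numbers \<open>s\<^sub>t\<close> and \<open>g\<^sub>t\<close> of small and large
  entries of column \<open>t\<close> matter.  Contracting edges of the meander realises the subtractive Euclidean
  algorithm, under which the generating polynomials change by \<open>(S, G) \<mapsto> (S, z (S + G))\<close> or
  \<open>(S, G) \<mapsto> (S + G, z G)\<close>.  The traces of products of these two matrices are palindromic, and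
  inductively this makes \<open>S + G\<close>, \<open>S\<close> and \<open>G\<close> unimodal with peaks at, to the left of, and to the right
  of the middle column; that suffices to place the large entries.  The Frobenius property gives
  coprimality of \<open>a\<close> and \<open>b\<close> by the same Euclidean algorithm, run on the radical of the form.
\<close>

section \<open>Frobenius parabolics have coprime block sizes\<close>

text \<open>Rows of the pyramid cross columns of different heights. If a row may turn from small to
  large but never back, then for columns t < u a left column that is not taller has at most as many
  large entries as the right one, and a right column that is not taller has at most as many small
  entries as the left one. These necessary comparisons also concern columns on opposite sides of the
  middle, and the heights need not be symmetric, so unimodality alone does not provide them.
  Comparing t and u by the sign of t + u minus a constant does. This control comes from the traces:
  up to a power of z, S + G differs from a palindromic polynomial by a single entry of the matrix of
  the word, and such entries are governed by shorter words. The palindromicity has a conceptual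
  source. For the letters L = ((1, 0), (z, z)) and R = ((1, 1), (0, z)), conjugation by diag(1,
  -1/z) takes the adjugate of X(z) to z X(1/z). Reflecting the trace of a word thus gives the trace
  of the reversed word, and for words in two 2 x 2 matrices these agree.\<close>

lemma mult_assoc_dim:
  fixes A :: "'a::semiring_0 mat"
  assumes "dim_col A = dim_row B" "dim_col B = dim_row C"
  shows "A * B * C = A * (B * C)"
  using assms by (intro assoc_mult_mat) auto

lemma mult_add_dim:
  fixes A :: "'a::semiring_0 mat"
  assumes "dim_col A = dim_row B" "dim_row B = dim_row C" "dim_col B = dim_col C"
  shows "A * (B + C) = A * B + A * C"
  using assms by (intro mult_add_distrib_mat) auto

lemma add_mult_dim:
  fixes A :: "'a::semiring_0 mat"
  assumes "dim_row A = dim_row B" "dim_col A = dim_col B" "dim_col B = dim_row C"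
  shows "(A + B) * C = A * C + B * C"
  using assms by (intro add_mult_distrib_mat) auto

lemma mult_minus_dim:
  fixes A :: "'a::ring mat"
  assumes "dim_col A = dim_row B" "dim_row B = dim_row C" "dim_col B = dim_col C"
  shows "A * (B - C) = A * B - A * C"
  using assms by (intro mult_minus_distrib_mat) auto

lemma minus_mult_dim:
  fixes A :: "'a::ring mat"
  assumes "dim_row A = dim_row B" "dim_col A = dim_col B" "dim_col B = dim_row C"
  shows "(A - B) * C = A * C - B * C"
  using assms by (intro minus_mult_distrib_mat) auto

lemma transpose_mult_dim:
  fixes A :: "'a::comm_semiring_0 mat"
  assumes "dim_col A = dim_row B"
  shows "(A * B)\<^sup>T = B\<^sup>T * A\<^sup>T"
  using assms by (intro transpose_mult) auto

lemma transpose_add_dim: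
  assumes "dim_row A = dim_row B" "dim_col A = dim_col B"
  shows "(A + B)\<^sup>T = A\<^sup>T + B\<^sup>T"
  using assms by (intro transpose_add) auto

lemma transpose_smult_one [simp]: "(c \<cdot>\<^sub>m 1\<^sub>m n)\<^sup>T = c \<cdot>\<^sub>m 1\<^sub>m n"
  by (intro eq_matI) auto

text \<open>Hypotheses on dimensions, unlike carrier hypotheses with free size variables, can be
  discharged by the simplifier, so that products of rectangular matrices can be normalised by
  rewriting.\<close>

lemmas mat_dim_simps = mult_assoc_dim mult_add_dim add_mult_dim mult_minus_dim minus_mult_dim

lemma add_zero_dim [simp]:
  fixes A :: "'a::monoid_add mat"
  assumes "dim_row A = n" "dim_col A = k"
  shows "A + 0\<^sub>m n k = A" "0\<^sub>m n k + A = A"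
  using assms by auto

lemma zero_mult_dim [simp]:
  fixes A :: "'a::semiring_0 mat"
  shows "dim_row A = k \<Longrightarrow> 0\<^sub>m n k * A = 0\<^sub>m n (dim_col A)"
    and "dim_col A = k \<Longrightarrow> A * 0\<^sub>m k n = 0\<^sub>m (dim_row A) n"
  by (auto simp: scalar_prod_def)

lemma one_mult_dim [simp]:
  fixes A :: "'a::semiring_1 mat"
  shows "dim_row A = n \<Longrightarrow> 1\<^sub>m n * A = A" and "dim_col A = n \<Longrightarrow> A * 1\<^sub>m n = A"
  by (auto simp: left_mult_one_mat right_mult_one_mat)

lemma add_minus_cancel_mat:
  fixes S T U V W :: "'a::ab_group_add mat"
  assumes "S \<in> carrier_mat n k" "T \<in> carrier_mat n k" "U \<in> carrier_mat n k"
    "V \<in> carrier_mat n k" "W \<in> carrier_mat n k"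
    and eq: "S + U + V = T + W"
  shows "S + (U + V - W) = T"
proof (intro eq_matI)
  fix i j assume ij: "i < dim_row T" "j < dim_col T"
  have "(S + U + V) $$ (i, j) = (T + W) $$ (i, j)" using eq by simp
  then show "(S + (U + V - W)) $$ (i, j) = T $$ (i, j)"
    using assms(1-5) ij by (simp add: algebra_simps)
qed (use assms in auto)

lemma add_eq_add_imp_eq_minus_mat:
  fixes S T U V :: "'a::ab_group_add mat"
  assumes "S \<in> carrier_mat n k" "T \<in> carrier_mat n k" "U \<in> carrier_mat n k" "V \<in> carrier_mat n k"
    and eq: "S + T = U + V"
  shows "T = U - S + V"
proof (intro eq_matI)
  fix i j assume ij: "i < dim_row (U - S + V)" "j < dim_col (U - S + V)"
  have "(S + T) $$ (i, j) = (U + V) $$ (i, j)" using eq by simp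
  then show "T $$ (i, j) = (U - S + V) $$ (i, j)"
    using assms(1-4) ij by (simp add: algebra_simps)
qed (use assms in auto)

text \<open>
  If the functional on the parabolic is \<open>X \<mapsto> tr (M X)\<close> with \<open>M\<close> block lower triangular with blocks
  \<open>A\<close>, \<open>C\<close>, \<open>D\<close>, these are the equations for \<open>[X, M]\<close> to annihilate the parabolic, where \<open>X\<close> is block
  upper triangular with blocks \<open>P\<close>, \<open>Q\<close>, \<open>R\<close>.
\<close>

definition rigid :: "nat \<Rightarrow> nat \<Rightarrow> complex mat \<Rightarrow> complex mat \<Rightarrow> complex mat \<Rightarrow> bool" where
  "rigid a b A C D \<longleftrightarrow>
     (\<forall>P Q R. P \<in> carrier_mat a a \<longrightarrow> Q \<in> carrier_mat a b \<longrightarrow> R \<in> carrier_mat b b \<longrightarrow>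
        R * C = C * P \<longrightarrow> P * A + Q * C = A * P \<longrightarrow> R * D = C * Q + D * R \<longrightarrow>
        (\<exists>c. P = c \<cdot>\<^sub>m 1\<^sub>m a \<and> Q = 0\<^sub>m a b \<and> R = c \<cdot>\<^sub>m 1\<^sub>m b))"

lemma rigidD:
  assumes "rigid a b A C D"
    and "P \<in> carrier_mat a a" "Q \<in> carrier_mat a b" "R \<in> carrier_mat b b"
    and "R * C = C * P" "P * A + Q * C = A * P" "R * D = C * Q + D * R"
  obtains c where "P = c \<cdot>\<^sub>m 1\<^sub>m a" "Q = 0\<^sub>m a b" "R = c \<cdot>\<^sub>m 1\<^sub>m b"
  using assms unfolding rigid_def by blast

text \<open>A solution \<open>P\<close>, \<open>Q\<close>, \<open>R\<close> of the transposed system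
  is a solution of the original one after transposing each block and exchanging the outer two. This
  is the swap of \<open>a\<close> and \<open>b\<close> in the Euclidean algorithm.\<close>

lemma rigid_transpose:
  assumes "rigid a b A C D"
    and [simp]: "A \<in> carrier_mat a a" "C \<in> carrier_mat b a" "D \<in> carrier_mat b b"
  shows "rigid b a D\<^sup>T C\<^sup>T A\<^sup>T"
  unfolding rigid_def
proof (intro allI impI)
  fix P Q R :: "complex mat"
  assume [simp]: "P \<in> carrier_mat b b" "Q \<in> carrier_mat b a" "R \<in> carrier_mat a a"
    and eq: "R * C\<^sup>T = C\<^sup>T * P" "P * D\<^sup>T + Q * C\<^sup>T = D\<^sup>T * P" "R * A\<^sup>T = C\<^sup>T * Q + A\<^sup>T * R"
  note dims = carrier_matD[OF assms(2)] carrier_matD[OF assms(3)] carrier_matD[OF assms(4)]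
    carrier_matD[OF \<open>P \<in> carrier_mat b b\<close>] carrier_matD[OF \<open>Q \<in> carrier_mat b a\<close>]
    carrier_matD[OF \<open>R \<in> carrier_mat a a\<close>]
  have 1: "P\<^sup>T * C = C * R\<^sup>T"
    using arg_cong[OF eq(1), of transpose_mat] by (simp add: transpose_mult_dim dims)
  have comm: "R\<^sup>T * A + Q\<^sup>T * C = Q\<^sup>T * C + R\<^sup>T * A"
    by (intro comm_add_mat[of _ a a] carrier_matI) (simp_all add: dims)
  have 2: "R\<^sup>T * A + Q\<^sup>T * C = A * R\<^sup>T"
    using arg_cong[OF eq(3), of transpose_mat]
    by (simp add: transpose_mult_dim transpose_add_dim dims comm)
  have comm': "C * Q\<^sup>T + D * P\<^sup>T = D * P\<^sup>T + C * Q\<^sup>T"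
    by (intro comm_add_mat[of _ b b] carrier_matI) (simp_all add: dims)
  have 3: "P\<^sup>T * D = C * Q\<^sup>T + D * P\<^sup>T"
    using arg_cong[OF eq(2), of transpose_mat]
    by (simp add: transpose_mult_dim transpose_add_dim dims comm')
  obtain c where c: "R\<^sup>T = c \<cdot>\<^sub>m 1\<^sub>m a" "Q\<^sup>T = 0\<^sub>m a b" "P\<^sup>T = c \<cdot>\<^sub>m 1\<^sub>m b"
    using rigidD[OF assms(1), of "R\<^sup>T" "Q\<^sup>T" "P\<^sup>T"] 1 2 3 by auto
  show "\<exists>c. P = c \<cdot>\<^sub>m 1\<^sub>m b \<and> Q = 0\<^sub>m b a \<and> R = c \<cdot>\<^sub>m 1\<^sub>m a"
    using arg_cong[OF c(1), of transpose_mat] arg_cong[OF c(2), of transpose_mat]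
      arg_cong[OF c(3), of transpose_mat]
    by (intro exI[of _ c]) simp
qed

section \<open>Consequences of rigidity and the Euclidean descent\<close>

text \<open>Vectors are kept as one-column matrices, so that the same identities apply to them.
  Padding with zero rows makes a wide matrix a singular square one.\<close>

lemma null_vector:
  fixes M :: "'a::field mat"
  assumes M: "M \<in> carrier_mat n k"
    and "n < k \<or> n = k \<and> det M = 0"
  obtains v where "v \<in> carrier_mat k 1" "v \<noteq> 0\<^sub>m k 1" "M * v = 0\<^sub>m n 1"
proof -
  have le: "n \<le> k" using assms by auto
  define N where "N = mat k k (\<lambda>(i, j). if i < n then M $$ (i, j) else 0)"
  have N: "N \<in> carrier_mat k k" by (simp add: N_def)
  have "det N = 0"
  proof (cases "n = k")
    case True
    then have "N = M" using M by (intro eq_matI) (auto simp: N_def)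
    then show ?thesis using assms True by auto
  next
    case False
    then have nk: "n < k" using le by simp
    have "row N n = 0\<^sub>v k" using nk by (intro eq_vecI) (auto simp: N_def)
    then have "N\<^sup>T *\<^sub>v unit_vec k n = 0\<^sub>v k" using nk N
      by (intro eq_vecI) (auto simp: N_def)
    moreover have "unit_vec k n \<noteq> (0\<^sub>v k :: 'a vec)" using nk by simp
    ultimately have "det (N\<^sup>T) = 0"
      using det_0_iff_vec_prod_zero_field[of "N\<^sup>T" k] N by (meson transpose_carrier_mat unit_vec_carrier)
    then show ?thesis using det_transpose[OF N] by simp
  qed
  then obtain v where v: "v \<in> carrier_vec k" "v \<noteq> 0\<^sub>v k" "N *\<^sub>v v = 0\<^sub>v k"
    using det_0_iff_vec_prod_zero_field[OF N] by auto
  define V where "V = mat k 1 (\<lambda>(i, j). v $ i)"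
  have "V \<in> carrier_mat k 1" by (simp add: V_def)
  moreover have "V \<noteq> 0\<^sub>m k 1"
  proof
    assume V0: "V = 0\<^sub>m k 1"
    have "v = 0\<^sub>v k"
    proof (intro eq_vecI)
      fix i assume "i < dim_vec (0\<^sub>v k :: 'a vec)"
      then have "V $$ (i, 0) = v $ i" "i < k" by (auto simp: V_def)
      then show "v $ i = 0\<^sub>v k $ i" by (simp add: V0)
    qed (use v in auto)
    then show False using v by simp
  qed
  moreover have "M * V = 0\<^sub>m n 1"
  proof (intro eq_matI)
    fix i j assume ij: "i < dim_row (0\<^sub>m n 1 :: 'a mat)" "j < dim_col (0\<^sub>m n 1 :: 'a mat)"
    have "(N *\<^sub>v v) $ i = 0" using v ij le by simp
    moreover have "(N *\<^sub>v v) $ i = (M * V) $$ (i, j)"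
      using ij le M v(1) by (auto simp: N_def V_def scalar_prod_def)
    ultimately show "(M * V) $$ (i, j) = 0\<^sub>m n 1 $$ (i, j)" using ij by simp
  qed (use M in \<open>auto simp: V_def\<close>)
  ultimately show thesis by (rule that)
qed

text \<open>A kernel vector v of \<open>C\<close> together with a left kernel vector w yields the
  nonzero solution P = 0, Q = v w^T, R = 0 of the rigidity equations. Such a w exists by dimension
  if \<open>a < b\<close>, and because v forces det C = 0 if \<open>a = b\<close>.\<close>

lemma injective_of_rigid:
  assumes rig: "rigid a b A C D" and le: "a \<le> b"
    and A: "A \<in> carrier_mat a a" and C: "C \<in> carrier_mat b a" and D: "D \<in> carrier_mat b b"
    and v: "v \<in> carrier_mat a 1" "C * v = 0\<^sub>m b 1"
  shows "v = 0\<^sub>m a 1"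
proof (rule ccontr)
  assume v0: "v \<noteq> 0\<^sub>m a 1"
  have CT: "C\<^sup>T \<in> carrier_mat a b" using C by simp
  have "a < b \<or> a = b \<and> det (C\<^sup>T) = 0"
  proof (cases "a = b")
    case True
    have "det C = 0"
    proof (rule ccontr)
      assume "det C \<noteq> 0"
      then obtain B where B: "B \<in> carrier_mat a a" "B * C = 1\<^sub>m a"
        using det_non_zero_imp_unit[of C a] C True by (auto simp: Units_def ring_mat_def)
      have "v = (B * C) * v" using B v by simp
      also have "\<dots> = B * (C * v)" using B v C True by (intro mult_assoc_dim) auto
      also have "\<dots> = 0\<^sub>m a 1" using v B True by simp
      finally show False using v0 by simp
    qed
    then show ?thesis using True C det_transpose[of C a] by simp
  qed (use le in simp)
  then obtain w where w: "w \<in> carrier_mat b 1" "w \<noteq> 0\<^sub>m b 1" "C\<^sup>T * w = 0\<^sub>m a 1"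
    using null_vector[OF CT] by blast
  have wC: "w\<^sup>T * C = 0\<^sub>m 1 a"
    using arg_cong[OF w(3), of transpose_mat] w(1) C by (simp add: transpose_mult_dim)
  obtain i where i: "i < a" "v $$ (i, 0) \<noteq> 0"
    using v0 v(1) by (auto simp: mat_eq_iff)
  obtain j where j: "j < b" "w $$ (j, 0) \<noteq> 0"
    using w(1,2) by (auto simp: mat_eq_iff)
  have "v * w\<^sup>T * C = 0\<^sub>m a a"
    using v(1) w(1) C wC by (subst mult_assoc_dim) auto
  moreover have "C * (v * w\<^sup>T) = 0\<^sub>m b b"
    using v w(1) C by (subst mult_assoc_dim[symmetric]) auto
  ultimately have "v * w\<^sup>T = 0\<^sub>m a b"
    using rigidD[OF rig, of "0\<^sub>m a a" "v * w\<^sup>T" "0\<^sub>m b b"] v(1) w(1) A C D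
    by auto
  then have "(v * w\<^sup>T) $$ (i, j) = 0" using i j by simp
  moreover have "(v * w\<^sup>T) $$ (i, j) = v $$ (i, 0) * w $$ (j, 0)"
    using i j v(1) w(1) by (auto simp: scalar_prod_def)
  ultimately show False using i j by simp
qed

text \<open>Columns are added one at a time. If w is a left null vector of the present matrix and
  its k-th entry is nonzero, the k-th unit vector is a legitimate new column: pairing a linear
  relation with w leaves only the coefficient of that column.\<close>

lemma extend_to_invertible:
  fixes C :: "'a::field mat"
  assumes C: "C \<in> carrier_mat b a" and "a \<le> b"
    and inj: "\<And>v. v \<in> carrier_mat a 1 \<Longrightarrow> C * v = 0\<^sub>m b 1 \<Longrightarrow> v = 0\<^sub>m a 1"
  obtains G where "G \<in> carrier_mat b b" "det G \<noteq> 0"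
    "\<And>i j. i < b \<Longrightarrow> j < a \<Longrightarrow> G $$ (i, j) = C $$ (i, j)"
proof -
  have "\<exists>G. G \<in> carrier_mat b b \<and> det G \<noteq> 0 \<and> (\<forall>i<b. \<forall>j<a. G $$ (i, j) = C $$ (i, j))"
    using assms
  proof (induction "b - a" arbitrary: a C)
    case 0
    then have ab: "a = b" by simp
    have "det C \<noteq> 0"
      using null_vector[of C b b] 0 ab by metis
    then show ?case using 0 ab by blast
  next
    case (Suc d)
    then have ab: "a < b" by simp
    have "C\<^sup>T \<in> carrier_mat a b" using Suc.prems by simp
    then obtain w where w: "w \<in> carrier_mat b 1" "w \<noteq> 0\<^sub>m b 1" "C\<^sup>T * w = 0\<^sub>m a 1"
      using null_vector[of "C\<^sup>T" a b] ab by blast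
    obtain k where k: "k < b" "w $$ (k, 0) \<noteq> 0"
      using w(1,2) by (auto simp: mat_eq_iff)
    have wC: "(\<Sum>i<b. w $$ (i, 0) * C $$ (i, j)) = 0" if "j < a" for j
    proof -
      have "(C\<^sup>T * w) $$ (j, 0) = 0" using w(3) that by simp
      then show ?thesis using that w(1) Suc.prems
        by (auto simp: scalar_prod_def atLeast0LessThan mult.commute)
    qed
    define C' where "C' = mat b (Suc a) (\<lambda>(i, j). if j < a then C $$ (i, j) else if i = k then 1 else 0)"
    have C': "C' \<in> carrier_mat b (Suc a)" by (simp add: C'_def)
    have "v = 0\<^sub>m (Suc a) 1" if v: "v \<in> carrier_mat (Suc a) 1" "C' * v = 0\<^sub>m b 1" for v
    proof -
      have eq: "(\<Sum>j<a. C $$ (i, j) * v $$ (j, 0)) + (if i = k then v $$ (a, 0) else 0) = 0" if "i < b" for i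
      proof -
        have "(C' * v) $$ (i, 0) = 0" using v that by simp
        then show ?thesis using that v(1)
          by (auto simp: C'_def scalar_prod_def atLeast0LessThan)
      qed
      have "0 = (\<Sum>i<b. w $$ (i, 0) * ((\<Sum>j<a. C $$ (i, j) * v $$ (j, 0)) + (if i = k then v $$ (a, 0) else 0)))"
        using eq by simp
      also have "\<dots> = (\<Sum>i<b. \<Sum>j<a. w $$ (i, 0) * C $$ (i, j) * v $$ (j, 0)) + w $$ (k, 0) * v $$ (a, 0)"
        using k(1) by (simp add: distrib_left sum.distrib sum_distrib_left mult.assoc if_distrib[of "\<lambda>x. _ * x"] cong: if_cong)
      also have "(\<Sum>i<b. \<Sum>j<a. w $$ (i, 0) * C $$ (i, j) * v $$ (j, 0)) = (\<Sum>j<a. (\<Sum>i<b. w $$ (i, 0) * C $$ (i, j)) * v $$ (j, 0))"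
        by (subst sum.swap) (simp add: sum_distrib_right)
      also have "\<dots> = 0" using wC by simp
      finally have va: "v $$ (a, 0) = 0" using k by simp
      define u where "u = mat a 1 (\<lambda>(i, j). v $$ (i, 0))"
      have u: "u \<in> carrier_mat a 1" by (simp add: u_def)
      have "C * u = 0\<^sub>m b 1"
      proof (intro eq_matI)
        fix i j assume ij: "i < dim_row (0\<^sub>m b 1 :: 'a mat)" "j < dim_col (0\<^sub>m b 1 :: 'a mat)"
        then have "(C * u) $$ (i, j) = (\<Sum>j<a. C $$ (i, j) * v $$ (j, 0))"
          using Suc.prems(1) by (auto simp: u_def scalar_prod_def atLeast0LessThan)
        then show "(C * u) $$ (i, j) = 0\<^sub>m b 1 $$ (i, j)" using eq[of i] va ij by (simp split: if_splits)
      qed (use Suc.prems(1) u in auto)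
      then have "u = 0\<^sub>m a 1" using Suc.prems(3) u by blast
      then have "v $$ (i, 0) = 0" if "i < a" for i
        using that by (auto simp: u_def mat_eq_iff)
      then show ?thesis using va v(1) by (intro eq_matI) (auto simp: less_Suc_eq)
    qed
    moreover have "d = b - Suc a" "Suc a \<le> b" using Suc.hyps(2) by auto
    ultimately obtain G where G: "G \<in> carrier_mat b b" "det G \<noteq> 0"
        "\<forall>i<b. \<forall>j<Suc a. G $$ (i, j) = C' $$ (i, j)"
      using Suc.hyps(1)[of "Suc a" C'] C' by blast
    moreover have "\<forall>i<b. \<forall>j<a. G $$ (i, j) = C $$ (i, j)"
      using G(3) ab by (simp add: C'_def)
    ultimately show ?case by blast
  qed
  then show thesis using that by blast
qed

text \<open>\<open>K\<close> completes \<open>C\<close> to an invertible matrix G = (C | K), and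
  \<open>L\<close> and \<open>N\<close> are the upper and lower parts of its inverse. The identities
  say blockwise that the two are inverse to each other.\<close>

lemma complement_of_injective:
  fixes C :: "'a::field mat"
  assumes C: "C \<in> carrier_mat b a" and ab: "a \<le> b"
    and inj: "\<And>v. v \<in> carrier_mat a 1 \<Longrightarrow> C * v = 0\<^sub>m b 1 \<Longrightarrow> v = 0\<^sub>m a 1"
  obtains K L N where "K \<in> carrier_mat b (b - a)" "L \<in> carrier_mat a b" "N \<in> carrier_mat (b - a) b"
    "L * C = 1\<^sub>m a" "L * K = 0\<^sub>m a (b - a)" "N * C = 0\<^sub>m (b - a) a" "N * K = 1\<^sub>m (b - a)"
    "C * L + K * N = 1\<^sub>m b"
proof -
  obtain G where G: "G \<in> carrier_mat b b" "det G \<noteq> 0"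
    and GC: "\<And>i j. i < b \<Longrightarrow> j < a \<Longrightarrow> G $$ (i, j) = C $$ (i, j)"
    using extend_to_invertible[OF assms] by blast
  obtain H where H: "H \<in> carrier_mat b b" "H * G = 1\<^sub>m b" "G * H = 1\<^sub>m b"
    using det_non_zero_imp_unit[OF G] by (auto simp: Units_def ring_mat_def)
  have HG: "(\<Sum>k<b. H $$ (i, k) * G $$ (k, j)) = (if i = j then 1 else 0)" if "i < b" "j < b" for i j
  proof -
    have "(H * G) $$ (i, j) = (if i = j then 1 else 0)" using H(2) that by simp
    then show ?thesis using that G H(1) by (simp add: scalar_prod_def atLeast0LessThan)
  qed
  have GH: "(\<Sum>k<b. G $$ (i, k) * H $$ (k, j)) = (if i = j then 1 else 0)" if "i < b" "j < b" for i j
  proof -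
    have "(G * H) $$ (i, j) = (if i = j then 1 else 0)" using H(3) that by simp
    then show ?thesis using that G H(1) by (simp add: scalar_prod_def atLeast0LessThan)
  qed
  define K where "K = mat b (b - a) (\<lambda>(i, j). G $$ (i, a + j))"
  define L where "L = mat a b (\<lambda>(i, j). H $$ (i, j))"
  define N where "N = mat (b - a) b (\<lambda>(i, j). H $$ (a + i, j))"
  note defs = K_def L_def N_def
  have [simp]: "dim_row C = b" "dim_col C = a" using C by auto
  note idx = scalar_prod_def atLeast0LessThan GC[symmetric]
  show thesis
  proof
    show "K \<in> carrier_mat b (b - a)" "L \<in> carrier_mat a b" "N \<in> carrier_mat (b - a) b"
      by (simp_all add: defs)
    show "L * C = 1\<^sub>m a"
      by (intro eq_matI) (use ab in \<open>auto simp: defs idx HG cong: sum.cong_simp\<close>)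
    show "L * K = 0\<^sub>m a (b - a)"
      by (intro eq_matI) (use ab in \<open>auto simp: defs idx HG cong: sum.cong_simp\<close>)
    show "N * C = 0\<^sub>m (b - a) a"
      by (intro eq_matI) (use ab in \<open>auto simp: defs idx HG cong: sum.cong_simp\<close>)
    show "N * K = 1\<^sub>m (b - a)"
      by (intro eq_matI) (use ab in \<open>auto simp: defs idx HG cong: sum.cong_simp\<close>)
    show "C * L + K * N = 1\<^sub>m b"
    proof (intro eq_matI)
      fix i j assume "i < dim_row (1\<^sub>m b :: 'a mat)" "j < dim_col (1\<^sub>m b :: 'a mat)"
      then have ij: "i < b" "j < b" by auto
      have "(C * L + K * N) $$ (i, j) =
          (\<Sum>k<a. G $$ (i, k) * H $$ (k, j)) + (\<Sum>k<b - a. G $$ (i, a + k) * H $$ (a + k, j))"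
        using ij ab by (auto simp: defs idx cong: sum.cong_simp)
      also have "(\<Sum>k<b - a. G $$ (i, a + k) * H $$ (a + k, j)) = (\<Sum>k=a..<b. G $$ (i, k) * H $$ (k, j))"
        using ab by (intro sum.reindex_bij_witness[of _ "\<lambda>k. k - a" "\<lambda>k. a + k"]) auto
      also have "(\<Sum>k<a. G $$ (i, k) * H $$ (k, j)) + \<dots> = (\<Sum>k<b. G $$ (i, k) * H $$ (k, j))"
        using ab by (simp add: sum.atLeastLessThan_concat flip: atLeast0LessThan)
      finally show "(C * L + K * N) $$ (i, j) = 1\<^sub>m b $$ (i, j)" using GH ij by simp
    qed (simp_all add: defs)
  qed
qed

text \<open>
  In a basis in which \<open>C\<close> is an identity block on top of a zero block, \<open>R\<close> is block triangular and
  \<open>Q\<close> is determined by the rest: a Euclidean step on \<open>(a, b)\<close>.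
\<close>

lemma rigid_reduce:
  assumes rig: "rigid a b A C D" and ab: "a < b"
    and A: "A \<in> carrier_mat a a" and C: "C \<in> carrier_mat b a" and D: "D \<in> carrier_mat b b"
  obtains A' C' D' where "A' \<in> carrier_mat a a" "C' \<in> carrier_mat (b - a) a"
    "D' \<in> carrier_mat (b - a) (b - a)" "rigid a (b - a) A' C' D'"
proof -
  obtain K L N where K: "K \<in> carrier_mat b (b - a)" and L: "L \<in> carrier_mat a b"
    and N: "N \<in> carrier_mat (b - a) b"
    and LC: "L * C = 1\<^sub>m a" and LK: "L * K = 0\<^sub>m a (b - a)"
    and NC: "N * C = 0\<^sub>m (b - a) a" and NK: "N * K = 1\<^sub>m (b - a)"
    and CLKN: "C * L + K * N = 1\<^sub>m b"
    using complement_of_injective[OF C less_imp_le[OF ab]]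
      injective_of_rigid[OF rig less_imp_le[OF ab] A C D] by metis
  have dims [simp]: "dim_row A = a" "dim_col A = a" "dim_row C = b" "dim_col C = a"
    "dim_row D = b" "dim_col D = b" "dim_row K = b" "dim_col K = b - a"
    "dim_row L = a" "dim_col L = b" "dim_row N = b - a" "dim_col N = b"
    using A C D K L N by auto
  have cancel: "L * (C * X) = X" "N * (C * X) = 0\<^sub>m (b - a) k" if "X \<in> carrier_mat a k" for X k
    using that mult_assoc_dim[of L C X] mult_assoc_dim[of N C X] LC NC by simp_all
  have cancel': "L * (K * X) = 0\<^sub>m a k" "N * (K * X) = X" if "X \<in> carrier_mat (b - a) k" for X k
    using that mult_assoc_dim[of L K X] mult_assoc_dim[of N K X] LK NK by simp_all
  \<comment> \<open>In the basis (C | K) the lower blocks of \<open>D\<close> are \<open>C'\<close>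
    and \<open>D'\<close>. The upper left block \<open>L * D * C\<close> ends up next to
    \<open>A\<close> once \<open>Q\<close> is eliminated from the second equation.\<close>
  define A' where "A' = A + L * D * C"
  define C' where "C' = N * D * C"
  define D' where "D' = N * D * K"
  have "rigid a (b - a) A' C' D'"
    unfolding rigid_def
  proof (intro allI impI)
    fix P Q' R' :: "complex mat"
    assume P: "P \<in> carrier_mat a a" and Q': "Q' \<in> carrier_mat a (b - a)"
      and R': "R' \<in> carrier_mat (b - a) (b - a)"
      and eq: "R' * C' = C' * P" "P * A' + Q' * C' = A' * P" "R' * D' = C' * Q' + D' * R'"
    have [simp]: "dim_row P = a" "dim_col P = a" "dim_row Q' = a" "dim_col Q' = b - a"
      "dim_row R' = b - a" "dim_col R' = b - a"
      using P Q' R' by auto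
    \<comment> \<open>The matrix that has blocks \<open>P\<close>, \<open>Q'\<close>, 0,
      \<open>R'\<close> in the basis (C | K).\<close>
    define R where "R = C * (P * L + Q' * N) + K * (R' * N)"
    have [simp]: "dim_row R = b" "dim_col R = b" by (simp_all add: R_def)
    have RC: "R * C = C * P"
    proof -
      have "R * C = C * (P * (L * C) + Q' * (N * C)) + K * (R' * (N * C))"
        by (simp add: R_def mat_dim_simps)
      also have "\<dots> = C * P"
        using P by (simp add: LC NC)
      finally show ?thesis .
    qed
    have RK: "R * K = C * Q' + K * R'"
    proof -
      have "R * K = C * (P * (L * K) + Q' * (N * K)) + K * (R' * (N * K))"
        by (simp add: R_def mat_dim_simps)
      then show ?thesis using Q' R' by (simp add: LK NK)
    qed
    have NR: "N * R = R' * N"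
    proof -
      have "N * R = N * (C * (P * L + Q' * N)) + N * (K * (R' * N))"
        by (simp add: R_def mult_add_dim)
      also have "N * (C * (P * L + Q' * N)) = 0\<^sub>m (b - a) b" by (rule cancel, rule carrier_matI) simp_all
      also have "N * (K * (R' * N)) = R' * N" by (rule cancel', rule carrier_matI) simp_all
      finally show ?thesis by simp
    qed
    have LR: "L * R = P * L + Q' * N"
    proof -
      have "L * R = L * (C * (P * L + Q' * N)) + L * (K * (R' * N))"
        by (simp add: R_def mult_add_dim)
      also have "L * (C * (P * L + Q' * N)) = P * L + Q' * N" by (rule cancel, rule carrier_matI) simp_all
      also have "L * (K * (R' * N)) = 0\<^sub>m a b" by (rule cancel', rule carrier_matI) simp_all
      finally show ?thesis by simp
    qed
    \<comment> \<open>\<open>C * Q\<close> has to equal \<open>E\<close>. The first and third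
      reduced equations amount to \<open>N * E = 0\<close>, so the columns of \<open>E\<close> lie
      in the image of \<open>C\<close> and \<open>Q = L * E\<close> is the right choice; the second
      reduced equation then becomes the second original one.\<close>
    define E where "E = R * D - D * R"
    have [simp]: "dim_row E = b" "dim_col E = b" by (simp_all add: E_def)
    have split: "X = X * C * L + X * K * N" if "dim_col X = b" for X
    proof -
      have "X = X * (C * L + K * N)" using that by (simp add: CLKN)
      also have "\<dots> = X * C * L + X * K * N" using that by (simp add: mat_dim_simps)
      finally show ?thesis .
    qed
    have NE: "N * E = R' * (N * D) - N * D * R"
      by (simp add: E_def mult_minus_dim NR flip: mult_assoc_dim)
    have NEC: "N * E * C = 0\<^sub>m (b - a) a"
    proof -
      have "N * E * C = R' * C' - C' * P"
        by (simp add: NE C'_def mat_dim_simps RC)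
      also have "R' * C' - C' * P = C' * P - C' * P" by (simp only: eq(1))
      also have "\<dots> = 0\<^sub>m (b - a) a" by (intro eq_matI) (simp_all add: C'_def)
      finally show ?thesis .
    qed
    have NEK: "N * E * K = 0\<^sub>m (b - a) (b - a)"
    proof -
      have "N * E * K = R' * D' - (C' * Q' + D' * R')"
        by (simp add: NE C'_def D'_def mat_dim_simps RK)
      also have "R' * D' - (C' * Q' + D' * R') = (C' * Q' + D' * R') - (C' * Q' + D' * R')"
        by (simp only: eq(3))
      also have "\<dots> = 0\<^sub>m (b - a) (b - a)" by (intro eq_matI) (simp_all add: C'_def D'_def)
      finally show ?thesis .
    qed
    have NE0: "N * E = 0\<^sub>m (b - a) b"
      using split[of "N * E"] by (simp add: NEC NEK)
    have CLE: "C * (L * E) = E"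
    proof -
      have "(C * L + K * N) * E = C * (L * E) + K * (N * E)"
        by (simp add: mat_dim_simps)
      then show ?thesis by (simp add: CLKN NE0)
    qed
    have LEC: "P * A + L * E * C = A * P"
    proof -
      have "L * E * C = P * (L * D * C) + Q' * C' - L * D * C * P"
      proof -
        have "L * E * C = L * R * (D * C) - L * D * (R * C)"
          by (simp add: E_def mat_dim_simps)
        also have "L * R * (D * C) = P * (L * D * C) + Q' * C'"
          by (simp add: LR C'_def mat_dim_simps)
        also have "L * D * (R * C) = L * D * C * P"
          by (simp add: RC mat_dim_simps)
        finally show ?thesis .
      qed
      moreover have "P * A + P * (L * D * C) + Q' * C' = A * P + L * D * C * P"
        using eq(2) by (simp add: A'_def mult_add_dim add_mult_dim)
      moreover have "P * A \<in> carrier_mat a a" "P * (L * D * C) \<in> carrier_mat a a"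
        "Q' * C' \<in> carrier_mat a a" "A * P \<in> carrier_mat a a" "L * D * C * P \<in> carrier_mat a a"
        by (rule carrier_matI; simp add: C'_def)+
      ultimately show ?thesis
        using add_minus_cancel_mat[of "P * A" a a "A * P" "P * (L * D * C)" "Q' * C'" "L * D * C * P"]
        by metis
    qed
    have LE_carrier: "L * E \<in> carrier_mat a b" and R_carrier: "R \<in> carrier_mat b b"
      by (rule carrier_matI; simp)+
    have "R * D = C * (L * E) + D * R"
      by (simp add: CLE) (auto simp: E_def mat_eq_iff simp del: index_mult_mat(1))
    then obtain c where c: "P = c \<cdot>\<^sub>m 1\<^sub>m a" "L * E = 0\<^sub>m a b" "R = c \<cdot>\<^sub>m 1\<^sub>m b"
      using rigidD[OF rig P _ _ RC LEC] by (metis LE_carrier R_carrier)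
    have "Q' = L * (R * K)"
      by (simp add: RK mult_add_dim cancel[OF Q'] cancel'[OF R'])
    also have "\<dots> = c \<cdot>\<^sub>m (L * K)"
      by (simp add: c mult_smult_distrib[OF L K] mult_smult_assoc_mat[OF one_carrier_mat K])
    finally have "Q' = 0\<^sub>m a (b - a)" by (simp add: LK)
    moreover have "R' = c \<cdot>\<^sub>m 1\<^sub>m (b - a)"
    proof -
      have "R' = N * (R * K)"
        by (simp add: RK mult_add_dim cancel[OF Q'] cancel'[OF R'])
      also have "\<dots> = c \<cdot>\<^sub>m (N * K)"
        by (simp add: c mult_smult_distrib[OF N K] mult_smult_assoc_mat[OF one_carrier_mat K])
      finally show ?thesis by (simp add: NK)
    qed
    ultimately show "\<exists>c. P = c \<cdot>\<^sub>m 1\<^sub>m a \<and> Q' = 0\<^sub>m a (b - a) \<and> R' = c \<cdot>\<^sub>m 1\<^sub>m (b - a)"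
      using c(1) by blast
  qed
  then show thesis
    by (intro that[of A' C' D'] carrier_matI) (simp_all add: A'_def C'_def D'_def)
qed

text \<open>With \<open>C\<close> invertible, the first two equations determine R = C P C^-1 and Q =
  (A P - P A) C^-1, and the third says that P commutes with W = A + C^-1 D C. So the centraliser of
  W consists of scalars. It contains W itself, hence it is the full matrix algebra, and only size 1
  remains.\<close>

lemma rigid_square:
  assumes rig: "rigid a a A C D" and a: "a \<ge> 1"
    and A: "A \<in> carrier_mat a a" and C: "C \<in> carrier_mat a a" and D: "D \<in> carrier_mat a a"
  shows "a = 1"
proof -
  obtain K L N where L: "L \<in> carrier_mat a a" and LC: "L * C = 1\<^sub>m a"
    using complement_of_injective[OF C order_refl]
      injective_of_rigid[OF rig order_refl A C D] by metis
  have CL: "C * L = 1\<^sub>m a" using mat_mult_left_right_inverse[OF L C LC] .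
  have [simp]: "dim_row A = a" "dim_col A = a" "dim_row C = a" "dim_col C = a"
    "dim_row D = a" "dim_col D = a" "dim_row L = a" "dim_col L = a"
    using A C D L by auto
  have CLX: "C * (L * X) = X" if "dim_row X = a" for X
    using that mult_assoc_dim[of C L X] CL by simp
  define W where "W = A + L * D * C"
  have W: "W \<in> carrier_mat a a" by (rule carrier_matI; simp add: W_def)
  have scalar: "\<exists>c. P = c \<cdot>\<^sub>m 1\<^sub>m a" if P: "P \<in> carrier_mat a a" and comm: "P * W = W * P" for P
  proof -
    have [simp]: "dim_row P = a" "dim_col P = a" using P by auto
    let ?Q = "(A * P - P * A) * L" and ?R = "C * P * L"
    have Q_carrier: "?Q \<in> carrier_mat a a" and R_carrier: "?R \<in> carrier_mat a a"
      by (rule carrier_matI; simp)+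
    have 1: "?R * C = C * P" using P by (simp add: mult_assoc_dim LC)
    have "?Q * C = A * P - P * A"
      by (simp add: mult_assoc_dim LC)
    then have 2: "P * A + ?Q * C = A * P"
      by (auto simp: mat_eq_iff simp del: index_mult_mat(1))
    have "C * (P * W) * L = C * (W * P) * L" using comm by simp
    then have "C * P * A * L + C * P * (L * D * C) * L = C * A * P * L + C * (L * D * C) * P * L"
      by (simp add: W_def mat_dim_simps)
    moreover have "C * P * (L * D * C) * L = ?R * D"
      using D by (simp add: mult_assoc_dim CL)
    moreover have "C * (L * D * C) * P * L = D * ?R"
      by (simp add: mult_assoc_dim CLX)
    moreover have "C * ?Q = C * A * P * L - C * P * A * L"
      by (simp add: mat_dim_simps)
    moreover have "C * P * A * L \<in> carrier_mat a a" "?R * D \<in> carrier_mat a a" "D * ?R \<in> carrier_mat a a"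
      "C * A * P * L \<in> carrier_mat a a"
      by (rule carrier_matI; simp)+
    ultimately have 3: "?R * D = C * ?Q + D * ?R"
      using add_eq_add_imp_eq_minus_mat[of "C * P * A * L" a a "?R * D" "C * A * P * L" "D * ?R"]
      by metis
    show ?thesis
      using rigidD[OF rig P _ _ 1 2 3] by (metis Q_carrier R_carrier)
  qed
  obtain c where c: "W = c \<cdot>\<^sub>m 1\<^sub>m a" using scalar[OF W] by blast
  have all_scalar: "\<exists>d. P = d \<cdot>\<^sub>m 1\<^sub>m a" if P: "P \<in> carrier_mat a a" for P :: "complex mat"
    using scalar[OF P] P
    by (simp add: c mult_smult_distrib[OF P one_carrier_mat] mult_smult_assoc_mat[OF one_carrier_mat P])
  show ?thesis
  proof (rule ccontr)
    assume "a \<noteq> 1"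
    then have a2: "a \<ge> 2" using a by simp
    define P :: "complex mat" where "P = mat a a (\<lambda>(i, j). if i = 0 \<and> j = 0 then 1 else 0)"
    obtain d where "P = d \<cdot>\<^sub>m 1\<^sub>m a" using all_scalar[of P] by (auto simp: P_def)
    then have "P $$ (0, 0) = P $$ (1, 1)" using a2 by simp
    then show False using a2 by (simp add: P_def)
  qed
qed

lemma coprime_of_rigid:
  assumes "rigid a b A C D" "a \<ge> 1" "b \<ge> 1"
    and "A \<in> carrier_mat a a" "C \<in> carrier_mat b a" "D \<in> carrier_mat b b"
  shows "coprime a b"
  using assms
\<comment> \<open>A reduction lowers the sum by at least 1, and the factor 2 pays for a possible
  rise of the flag. A transposition keeps the sum and clears the flag.\<close>
proof (induction "2 * (a + b) + (if b < a then 1 else 0)" arbitrary: a b A C D rule: less_induct)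
  case less
  consider "a = b" | "a < b" | "b < a" by linarith
  then show ?case
  proof cases
    case 1
    then show ?thesis using rigid_square less.prems by fastforce
  next
    case 2
    obtain A' C' D' where *: "A' \<in> carrier_mat a a" "C' \<in> carrier_mat (b - a) a"
      "D' \<in> carrier_mat (b - a) (b - a)" "rigid a (b - a) A' C' D'"
      using rigid_reduce[OF less.prems(1) 2 less.prems(4-6)] by blast
    have "coprime a (b - a)"
      by (rule less.hyps[OF _ *(4) _ _ *(1-3)]) (use 2 less.prems in auto)
    moreover obtain d where "b = a + d" using 2 less_imp_add_positive by blast
    ultimately show ?thesis by (simp add: coprime_iff_gcd_eq_1)
  next
    case 3
    have "coprime b a"
      by (rule less.hyps[OF _ rigid_transpose[OF less.prems(1,4-6)]]) (use 3 less.prems in auto)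
    then show ?thesis by (simp add: coprime_commute)
  qed
qed

section \<open>Functionals on the parabolic as trace forms\<close>

lemma mem_maximal_parabolic:
  "X \<in> maximal_parabolic a b \<longleftrightarrow>
     X \<in> carrier_mat (a + b) (a + b) \<and> (\<Sum>i<a + b. X $$ (i, i)) = 0 \<and>
     (\<forall>i<a + b. \<forall>j<a. a \<le> i \<longrightarrow> X $$ (i, j) = 0)"
proof -
  have "(\<forall>i\<in>{1..a + b}. \<forall>j\<in>{1..a + b}. i > a \<and> j \<le> a \<longrightarrow> X $$ (i - 1, j - 1) = 0) \<longleftrightarrow>
      (\<forall>i<a + b. \<forall>j<a. a \<le> i \<longrightarrow> X $$ (i, j) = 0)" (is "?l \<longleftrightarrow> ?r")
  proof
    assume l: ?l
    show ?r
    proof (intro allI impI)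
      fix i j assume "i < a + b" "j < a" "a \<le> i"
      then show "X $$ (i, j) = 0"
        using l[rule_format, of "Suc i" "Suc j"] by simp
    qed
  qed auto
  then show ?thesis by (simp add: maximal_parabolic_def)
qed

lemma add_mem_parabolic:
  "X \<in> maximal_parabolic a b \<Longrightarrow> Y \<in> maximal_parabolic a b \<Longrightarrow> X + Y \<in> maximal_parabolic a b"
  by (auto simp: mem_maximal_parabolic sum.distrib)

lemma smult_mem_parabolic:
  "X \<in> maximal_parabolic a b \<Longrightarrow> c \<cdot>\<^sub>m X \<in> maximal_parabolic a b"
  by (auto simp: mem_maximal_parabolic simp flip: sum_distrib_left)

lemma zero_mem_parabolic: "0\<^sub>m (a + b) (a + b) \<in> maximal_parabolic a b"
  by (auto simp: mem_maximal_parabolic)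

text \<open>Additivity of \<open>F\<close> is available only inside the parabolic, so membership of
  the partial sums is carried through the same induction.\<close>

lemma linear_functional_sum:
  fixes a b
  defines "n \<equiv> a + b"
  assumes F: "linear_functional_on (maximal_parabolic a b) F" and "finite I"
    and B: "\<And>k. k \<in> I \<Longrightarrow> B k \<in> maximal_parabolic a b"
  shows "mat n n (\<lambda>x. \<Sum>k\<in>I. c k * B k $$ x) \<in> maximal_parabolic a b \<and>
    F (mat n n (\<lambda>x. \<Sum>k\<in>I. c k * B k $$ x)) = (\<Sum>k\<in>I. c k * F (B k))"
  using \<open>finite I\<close> B
proof (induction I rule: finite_induct)
  case empty
  have *: "mat n n (\<lambda>x. \<Sum>k\<in>{}. c k * B k $$ x) = 0 \<cdot>\<^sub>m 0\<^sub>m n n"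
    by (intro eq_matI) auto
  have "F (0 \<cdot>\<^sub>m 0\<^sub>m n n) = 0"
    using F zero_mem_parabolic[of a b] unfolding linear_functional_on_def n_def by (metis mult_zero_left)
  then show ?case
    unfolding * using zero_mem_parabolic[of a b] smult_mem_parabolic by (auto simp: n_def)
next
  case (insert i I)
  let ?X = "mat n n (\<lambda>x. \<Sum>k\<in>I. c k * B k $$ x)"
  have Bi: "B i \<in> carrier_mat n n" "B i \<in> maximal_parabolic a b"
    using insert.prems by (auto simp: mem_maximal_parabolic n_def)
  have *: "mat n n (\<lambda>x. \<Sum>k\<in>insert i I. c k * B k $$ x) = c i \<cdot>\<^sub>m B i + ?X"
    using insert.hyps Bi by (intro eq_matI) auto
  have X: "?X \<in> maximal_parabolic a b" "F ?X = (\<Sum>k\<in>I. c k * F (B k))"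
    using insert by auto
  have "F (c i \<cdot>\<^sub>m B i + ?X) = F (c i \<cdot>\<^sub>m B i) + F ?X"
    using F X(1) smult_mem_parabolic[OF Bi(2)] unfolding linear_functional_on_def by blast
  also have "F (c i \<cdot>\<^sub>m B i) = c i * F (B i)"
    using F Bi(2) unfolding linear_functional_on_def by blast
  finally have "F (c i \<cdot>\<^sub>m B i + ?X) = c i * F (B i) + F ?X" .
  then show ?case
    unfolding * using insert.hyps X add_mem_parabolic smult_mem_parabolic Bi(2) by simp
qed

lemma trace_mult:
  fixes X Y :: "complex mat"
  assumes "X \<in> carrier_mat n n" "Y \<in> carrier_mat n n"
  shows "(\<Sum>i<n. (X * Y) $$ (i, i)) = (\<Sum>i<n. \<Sum>k<n. X $$ (i, k) * Y $$ (k, i))"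
  using assms by (intro sum.cong) (auto simp: scalar_prod_def atLeast0LessThan)

lemma trace_mult_commute:
  fixes X Y :: "complex mat"
  assumes "X \<in> carrier_mat n n" "Y \<in> carrier_mat n n"
  shows "(\<Sum>i<n. (X * Y) $$ (i, i)) = (\<Sum>i<n. (Y * X) $$ (i, i))"
  unfolding trace_mult[OF assms] trace_mult[OF assms(2,1)]
  by (subst sum.swap) (simp add: mult.commute)

lemma mult_parabolic_eq_0:
  fixes X Y :: "complex mat"
  assumes "X \<in> maximal_parabolic a b" "Y \<in> maximal_parabolic a b"
    and "i < a + b" "j < a" "a \<le> i"
  shows "(X * Y) $$ (i, j) = 0"
proof -
  have X: "X \<in> carrier_mat (a + b) (a + b)" and Y: "Y \<in> carrier_mat (a + b) (a + b)"
    and X0: "\<And>k. k < a \<Longrightarrow> X $$ (i, k) = 0" and Y0: "\<And>k. k < a + b \<Longrightarrow> a \<le> k \<Longrightarrow> Y $$ (k, j) = 0"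
    using assms by (auto simp: mem_maximal_parabolic)
  have "(X * Y) $$ (i, j) = (\<Sum>k<a + b. X $$ (i, k) * Y $$ (k, j))"
    using X Y assms(3,4) by (auto simp: scalar_prod_def atLeast0LessThan)
  also have "\<dots> = 0"
    using X0 Y0 by (intro sum.neutral) (metis lessThan_iff linorder_not_le mult_zero_left mult_zero_right)
  finally show ?thesis .
qed

lemma bracket_mem_parabolic:
  assumes X: "X \<in> maximal_parabolic a b" and Y: "Y \<in> maximal_parabolic a b"
  shows "mat_bracket X Y \<in> maximal_parabolic a b"
proof -
  have c: "X \<in> carrier_mat (a + b) (a + b)" "Y \<in> carrier_mat (a + b) (a + b)"
    using X Y by (auto simp: mem_maximal_parabolic)
  have "(\<Sum>i<a + b. (X * Y - Y * X) $$ (i, i)) = (\<Sum>i<a + b. (X * Y) $$ (i, i) - (Y * X) $$ (i, i))"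
    using c by (intro sum.cong) auto
  also have "\<dots> = 0" by (simp add: sum_subtractf trace_mult_commute[OF c])
  finally show ?thesis
    using c mult_parabolic_eq_0[OF X Y] mult_parabolic_eq_0[OF Y X]
    by (auto simp: mem_maximal_parabolic mat_bracket_def simp del: index_mult_mat(1))
qed

lemma functional_eq_trace:
  fixes a b
  defines "n \<equiv> a + b"
  assumes F: "linear_functional_on (maximal_parabolic a b) F" and n: "n \<ge> 1"
  obtains M where "M \<in> carrier_mat n n" "\<And>i j. i < a \<Longrightarrow> a \<le> j \<Longrightarrow> j < n \<Longrightarrow> M $$ (i, j) = 0"
    "\<And>X. X \<in> maximal_parabolic a b \<Longrightarrow> F X = (\<Sum>i<n. (M * X) $$ (i, i))"
proof
  define I where "I = {(i, j). i < n \<and> j < n \<and> \<not> (a \<le> i \<and> j < a)}"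
  have finI: "finite I" by (rule finite_subset[of _ "{..<n} \<times> {..<n}"]) (auto simp: I_def)
  \<comment> \<open>Matrix units with their scalar part removed, so that \<open>F\<close> may be
    applied to them. In the expansion of a matrix of trace zero the corrections on the diagonal
    cancel.\<close>
  define B :: "nat \<times> nat \<Rightarrow> complex mat" where
    "B = (\<lambda>(i, j). mat n n (\<lambda>x. (if x = (i, j) then 1 else 0) -
       (if i = j \<and> fst x = snd x then 1 / of_nat n else 0)))"
  have B: "B k \<in> maximal_parabolic a b" if "k \<in> I" for k
  proof -
    obtain i j where k: "k = (i, j)" by force
    have "(\<Sum>r<n. B k $$ (r, r)) =
        (\<Sum>r<n. (if i = j \<and> r = i then 1 else 0) - (if i = j then 1 / of_nat n else 0))"
      by (intro sum.cong) (auto simp: B_def k)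
    also have "\<dots> = 0"
      using that n by (auto simp: k I_def sum_subtractf)
    finally show ?thesis
      using that by (auto simp: mem_maximal_parabolic B_def k I_def n_def)
  qed
  \<comment> \<open>Indices are exchanged because tr (M X) pairs the entry (i, j) of
    \<open>M\<close> with the entry (j, i) of \<open>X\<close>. The upper right block meets zeros of
    \<open>X\<close> and is set to 0.\<close>
  define M where "M = mat n n (\<lambda>(i, j). if (j, i) \<in> I then F (B (j, i)) else 0)"
  show M: "M \<in> carrier_mat n n" by (simp add: M_def)
  show "M $$ (i, j) = 0" if "i < a" "a \<le> j" "j < n" for i j
    using that by (auto simp: M_def I_def n_def)
  show "F X = (\<Sum>i<n. (M * X) $$ (i, i))" if X: "X \<in> maximal_parabolic a b" for X
  proof -
    have Xc: "X \<in> carrier_mat n n" and tr: "(\<Sum>i<n. X $$ (i, i)) = 0"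
      and X0: "\<And>i j. i < n \<Longrightarrow> j < n \<Longrightarrow> (i, j) \<notin> I \<Longrightarrow> X $$ (i, j) = 0"
      using X by (auto simp: mem_maximal_parabolic n_def I_def)
    have "X = mat n n (\<lambda>x. \<Sum>k\<in>I. X $$ k * B k $$ x)"
    proof (intro eq_matI)
      fix r s assume "r < dim_row (mat n n (\<lambda>x. \<Sum>k\<in>I. X $$ k * B k $$ x))"
        "s < dim_col (mat n n (\<lambda>x. \<Sum>k\<in>I. X $$ k * B k $$ x))"
      then have rs: "r < n" "s < n" by auto
      have "(\<Sum>k\<in>I. X $$ k * B k $$ (r, s)) =
          (\<Sum>k\<in>I. (if k = (r, s) then X $$ k else 0) -
            (if fst k = snd k \<and> r = s then X $$ k / of_nat n else 0))"
      proof (intro sum.cong refl)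
        fix k :: "nat \<times> nat"
        have "B k $$ (r, s) = (if k = (r, s) then 1 else 0) -
            (if fst k = snd k \<and> r = s then 1 / of_nat n else 0)"
          using rs by (cases k) (auto simp: B_def)
        then show "X $$ k * B k $$ (r, s) = (if k = (r, s) then X $$ k else 0) -
            (if fst k = snd k \<and> r = s then X $$ k / of_nat n else 0)"
          by (simp add: right_diff_distrib)
      qed
      also have "\<dots> = (\<Sum>k\<in>I. (if k = (r, s) then X $$ k else 0)) -
          (\<Sum>k\<in>I. if fst k = snd k \<and> r = s then X $$ k / of_nat n else 0)"
        by (rule sum_subtractf)
      also have "(\<Sum>k\<in>I. (if k = (r, s) then X $$ k else 0)) = X $$ (r, s)"
        using finI X0 rs by simp
      also have "(\<Sum>k\<in>I. if fst k = snd k \<and> r = s then X $$ k / of_nat n else 0) = 0"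
      proof (cases "r = s")
        case True
        have "(\<Sum>k\<in>I. if fst k = snd k \<and> r = s then X $$ k / of_nat n else 0) =
            (\<Sum>k\<in>(\<lambda>i. (i, i)) ` {..<n}. X $$ k / of_nat n)"
          using finI True by (intro sum.mono_neutral_cong_right) (auto simp: I_def)
        also have "\<dots> = (\<Sum>i<n. X $$ (i, i) / of_nat n)"
          by (subst sum.reindex) (auto intro: inj_onI)
        also have "\<dots> = 0" using tr by (simp flip: sum_divide_distrib)
        finally show ?thesis .
      qed auto
      finally show "X $$ (r, s) = mat n n (\<lambda>x. \<Sum>k\<in>I. X $$ k * B k $$ x) $$ (r, s)"
        using rs by simp
    qed (use Xc in auto)
    then have "F X = F (mat n n (\<lambda>x. \<Sum>k\<in>I. X $$ k * B k $$ x))"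
      by (rule arg_cong)
    also have "\<dots> = (\<Sum>k\<in>I. X $$ k * F (B k))"
      unfolding n_def by (rule conjunct2[OF linear_functional_sum[OF F finI B, where c = "\<lambda>k. X $$ k"]])
    also have "\<dots> = (\<Sum>k\<in>{..<n} \<times> {..<n}. X $$ k * M $$ (snd k, fst k))"
      by (intro sum.mono_neutral_cong_left) (auto simp: I_def M_def)
    also have "\<dots> = (\<Sum>i<n. \<Sum>j<n. X $$ (i, j) * M $$ (j, i))"
      by (simp add: sum.cartesian_product case_prod_beta)
    also have "\<dots> = (\<Sum>i<n. (X * M) $$ (i, i))"
      by (rule trace_mult[OF Xc M, symmetric])
    also have "\<dots> = (\<Sum>i<n. (M * X) $$ (i, i))"
      by (rule trace_mult_commute[OF Xc M])
    finally show ?thesis .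
  qed
qed

lemma rigid_of_frobenius:
  fixes a b
  assumes fr: "frobenius (a + b) (maximal_parabolic a b)" and a: "a \<ge> 1"
  obtains A C D where "A \<in> carrier_mat a a" "C \<in> carrier_mat b a" "D \<in> carrier_mat b b"
    "rigid a b A C D"
proof -
  define n where "n = a + b"
  have n: "n \<ge> 1" using a by (simp add: n_def)
  obtain F where F: "linear_functional_on (maximal_parabolic a b) F"
    and nondeg: "\<And>X. X \<in> maximal_parabolic a b \<Longrightarrow>
      (\<And>Y. Y \<in> maximal_parabolic a b \<Longrightarrow> F (mat_bracket X Y) = 0) \<Longrightarrow> X = 0\<^sub>m n n"
    using fr unfolding frobenius_def n_def by blast
  obtain M where M: "M \<in> carrier_mat n n" and M0: "\<And>i j. i < a \<Longrightarrow> a \<le> j \<Longrightarrow> j < n \<Longrightarrow> M $$ (i, j) = 0"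
    and FM: "\<And>X. X \<in> maximal_parabolic a b \<Longrightarrow> F X = (\<Sum>i<n. (M * X) $$ (i, i))"
    using functional_eq_trace[OF F] n unfolding n_def by blast
  define A where "A = mat a a (\<lambda>(i, j). M $$ (i, j))"
  define C where "C = mat b a (\<lambda>(i, j). M $$ (a + i, j))"
  define D where "D = mat b b (\<lambda>(i, j). M $$ (a + i, a + j))"
  have cAD: "A \<in> carrier_mat a a" "C \<in> carrier_mat b a" "D \<in> carrier_mat b b"
    by (simp_all add: A_def C_def D_def)
  have Mblock: "M = four_block_mat A (0\<^sub>m a b) C D"
    using M M0 by (intro eq_matI) (auto simp: A_def C_def D_def n_def)
  have "rigid a b A C D"
    unfolding rigid_def
  proof (intro allI impI)
    fix P Q R :: "complex mat"
    assume P: "P \<in> carrier_mat a a" and Q: "Q \<in> carrier_mat a b" and R: "R \<in> carrier_mat b b"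
      and eq: "R * C = C * P" "P * A + Q * C = A * P" "R * D = C * Q + D * R"
    define X where "X = four_block_mat P Q (0\<^sub>m b a) R"
    have X: "X \<in> carrier_mat n n" using P R by (auto simp: X_def n_def)
    have MX: "M * X = four_block_mat (A * P) (A * Q) (C * P) (C * Q + D * R)"
      unfolding Mblock X_def using P Q R cAD
      by (subst mult_four_block_mat[of _ a a _ b _ b]) auto
    have XM: "X * M = four_block_mat (P * A + Q * C) (Q * D) (R * C) (R * D)"
      unfolding Mblock X_def using P Q R cAD
      by (subst mult_four_block_mat[of _ a a _ b _ b]) auto
    \<comment> \<open>Only in the upper right block may the two products differ; under the trace
      that block is paired with the lower left block of \<open>Y\<close>, which vanishes.\<close>
    have comm: "(M * X) $$ (i, k) = (X * M) $$ (i, k)" if "i < n" "k < n" "a \<le> i \<or> k < a" for i k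
      unfolding MX XM eq using that P Q R cAD
      by (auto simp: n_def simp del: index_mult_mat(1))
    \<comment> \<open>Rigidity is about block triangular matrices of arbitrary trace. Removing the
      scalar part of \<open>X\<close> moves it into the parabolic and leaves its commutator with
      \<open>M\<close> unchanged.\<close>
    define t where "t = (\<Sum>i<n. X $$ (i, i)) / of_nat n"
    define X' where "X' = X - t \<cdot>\<^sub>m 1\<^sub>m n"
    have X'c: "X' \<in> carrier_mat n n" using X by (simp add: X'_def minus_carrier_mat)
    have "(\<Sum>i<n. X' $$ (i, i)) = (\<Sum>i<n. X $$ (i, i) - t)"
      using X by (intro sum.cong) (auto simp: X'_def)
    also have "\<dots> = 0" using n by (simp add: sum_subtractf t_def)
    finally have X': "X' \<in> maximal_parabolic a b"
      using X'c P R by (auto simp: mem_maximal_parabolic n_def X'_def X_def)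
    have MX': "M * X' = M * X - t \<cdot>\<^sub>m M" "X' * M = X * M - t \<cdot>\<^sub>m M"
      using M X by (simp_all add: X'_def mult_minus_dim minus_mult_dim
          mult_smult_distrib[OF M one_carrier_mat] mult_smult_assoc_mat[OF one_carrier_mat M])
    have comm': "(M * X') $$ (i, k) = (X' * M) $$ (i, k)" if "i < n" "k < n" "a \<le> i \<or> k < a" for i k
      unfolding MX' using comm[OF that] that M X by (simp del: index_mult_mat(1))
    have "F (mat_bracket X' Y) = 0" if Y: "Y \<in> maximal_parabolic a b" for Y
    proof -
      have Yc: "Y \<in> carrier_mat n n" using Y by (simp add: mem_maximal_parabolic n_def)
      have Y0: "Y $$ (k, i) = 0" if "a \<le> k" "k < n" "i < a" for i k
        using Y that by (auto simp: mem_maximal_parabolic n_def)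
      have c: "M * X' \<in> carrier_mat n n" "X' * M \<in> carrier_mat n n" "M * Y \<in> carrier_mat n n"
        using M X'c Yc by auto
      have "F (mat_bracket X' Y) = (\<Sum>i<n. (M * (X' * Y) - M * (Y * X')) $$ (i, i))"
        using FM[OF bracket_mem_parabolic[OF X' Y]] M X'c Yc
        by (simp add: mat_bracket_def mult_minus_dim)
      also have "\<dots> = (\<Sum>i<n. (M * X' * Y) $$ (i, i)) - (\<Sum>i<n. (M * Y * X') $$ (i, i))"
        using M X'c Yc by (simp add: sum_subtractf del: index_mult_mat(1))
      also have "(\<Sum>i<n. (M * Y * X') $$ (i, i)) = (\<Sum>i<n. (X' * M * Y) $$ (i, i))"
        using trace_mult_commute[OF c(3) X'c] M X'c Yc by simp
      also have "(\<Sum>i<n. (M * X' * Y) $$ (i, i)) - (\<Sum>i<n. (X' * M * Y) $$ (i, i)) =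
          (\<Sum>i<n. \<Sum>k<n. ((M * X') $$ (i, k) - (X' * M) $$ (i, k)) * Y $$ (k, i))"
        unfolding trace_mult[OF c(1) Yc] trace_mult[OF c(2) Yc]
        by (simp add: sum_subtractf left_diff_distrib)
      also have "\<dots> = 0"
      proof (intro sum.neutral ballI)
        fix i k assume "i \<in> {..<n}" "k \<in> {..<n}"
        then show "((M * X') $$ (i, k) - (X' * M) $$ (i, k)) * Y $$ (k, i) = 0"
          using comm'[of i k] Y0[of k i] by (cases "a \<le> i \<or> k < a") auto
      qed
      finally show ?thesis .
    qed
    then have "X' = 0\<^sub>m n n" using nondeg[OF X'] by blast
    then have Xe: "X $$ (i, j) = (if i = j then t else 0)" if "i < n" "j < n" for i j
    proof -
      have "X' $$ (i, j) = 0" using \<open>X' = 0\<^sub>m n n\<close> that by simp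
      then show ?thesis using X that by (auto simp: X'_def split: if_splits)
    qed
    have "P = t \<cdot>\<^sub>m 1\<^sub>m a"
    proof (intro eq_matI)
      fix i j assume "i < dim_row (t \<cdot>\<^sub>m 1\<^sub>m a)" "j < dim_col (t \<cdot>\<^sub>m 1\<^sub>m a)"
      then show "P $$ (i, j) = (t \<cdot>\<^sub>m 1\<^sub>m a) $$ (i, j)"
        using Xe[of i j] P R by (auto simp: X_def n_def)
    qed (use P in auto)
    moreover have "Q = 0\<^sub>m a b"
    proof (intro eq_matI)
      fix i j assume "i < dim_row (0\<^sub>m a b :: complex mat)" "j < dim_col (0\<^sub>m a b :: complex mat)"
      then show "Q $$ (i, j) = 0\<^sub>m a b $$ (i, j)"
        using Xe[of i "a + j"] P R by (auto simp: X_def n_def)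
    qed (use Q in auto)
    moreover have "R = t \<cdot>\<^sub>m 1\<^sub>m b"
    proof (intro eq_matI)
      fix i j assume "i < dim_row (t \<cdot>\<^sub>m 1\<^sub>m b)" "j < dim_col (t \<cdot>\<^sub>m 1\<^sub>m b)"
      then show "R $$ (i, j) = (t \<cdot>\<^sub>m 1\<^sub>m b) $$ (i, j)"
        using Xe[of "a + i" "a + j"] P R by (auto simp: X_def n_def)
    qed (use R in auto)
    ultimately show "\<exists>c. P = c \<cdot>\<^sub>m 1\<^sub>m a \<and> Q = 0\<^sub>m a b \<and> R = c \<cdot>\<^sub>m 1\<^sub>m b" by blast
  qed
  then show thesis using that cAD by blast
qed

theorem coprime_of_frobenius:
  assumes "a \<ge> 1" "b \<ge> 1" "frobenius (a + b) (maximal_parabolic a b)"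
  shows "coprime a b"
  using rigid_of_frobenius[OF assms(3,1)] coprime_of_rigid assms by metis

section \<open>Palindromic traces and interlaced sequences\<close>

type_synonym seq = "int \<Rightarrow> int"

text \<open>
  \<open>True\<close> encodes the step \<open>(a, b) \<mapsto> (a, a + b)\<close> and \<open>False\<close> the step \<open>(a, b) \<mapsto> (a + b, b)\<close>.  A word acts
  as a \<open>2 \<times> 2\<close> matrix over \<open>\<int>[z]\<close>; polynomials are given by their coefficient functions, so that
  multiplication by \<open>z\<close> is the shift \<open>t \<mapsto> t - 1\<close>.
\<close>

fun word_act :: "bool list \<Rightarrow> seq \<times> seq \<Rightarrow> seq \<times> seq" where
  "word_act [] x = x"
| "word_act (True # w) x = (case word_act w x of (s, g) \<Rightarrow> (s, \<lambda>t. s (t - 1) + g (t - 1)))"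
| "word_act (False # w) x = (case word_act w x of (s, g) \<Rightarrow> (\<lambda>t. s t + g t, \<lambda>t. g (t - 1)))"

definition unit_seq :: seq where "unit_seq t = (if t = 0 then 1 else 0)"

text \<open>The two columns of the matrix of the word, and its product with the vector (1, z). That
  vector describes the pyramid for a = b = 1: a small entry in column 0 and a large one in column
  1.\<close>

definition "col1 w = word_act w (unit_seq, \<lambda>t. 0)"
definition "col2 w = word_act w (\<lambda>t. 0, unit_seq)"
definition "column_counts w = word_act w (unit_seq, \<lambda>t. unit_seq (t - 1))"

lemma word_act_append: "word_act (v @ w) x = word_act v (word_act w x)"
  by (induction v x rule: word_act.induct) auto

lemma col1_simps:
  "col1 [] = (unit_seq, \<lambda>t. 0)"
  "col1 (True # w) = (fst (col1 w), \<lambda>t. fst (col1 w) (t - 1) + snd (col1 w) (t - 1))"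
  "col1 (False # w) = (\<lambda>t. fst (col1 w) t + snd (col1 w) t, \<lambda>t. snd (col1 w) (t - 1))"
  by (simp_all add: col1_def split: prod.splits)

lemma col2_simps:
  "col2 [] = (\<lambda>t. 0, unit_seq)"
  "col2 (True # w) = (fst (col2 w), \<lambda>t. fst (col2 w) (t - 1) + snd (col2 w) (t - 1))"
  "col2 (False # w) = (\<lambda>t. fst (col2 w) t + snd (col2 w) t, \<lambda>t. snd (col2 w) (t - 1))"
  by (simp_all add: col2_def split: prod.splits)

lemma column_counts_simps:
  "column_counts [] = (unit_seq, \<lambda>t. unit_seq (t - 1))"
  "column_counts (True # w) = (fst (column_counts w), \<lambda>t. fst (column_counts w) (t - 1) + snd (column_counts w) (t - 1))"
  "column_counts (False # w) = (\<lambda>t. fst (column_counts w) t + snd (column_counts w) t, \<lambda>t. snd (column_counts w) (t - 1))"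
  by (simp_all add: column_counts_def split: prod.splits)

lemma column_counts_eq_cols:
  "fst (column_counts w) t = fst (col1 w) t + fst (col2 w) (t - 1)
   \<and> snd (column_counts w) t = snd (col1 w) t + snd (col2 w) (t - 1)"
proof (induction w arbitrary: t)
  case (Cons x w)
  then show ?case by (cases x) (auto simp: col1_simps col2_simps column_counts_simps)
qed (auto simp: col1_simps col2_simps column_counts_simps)

text \<open>
  With \<open>M\<close> the matrix of the word, these are the traces of \<open>M\<close>, \<open>M L\<close>, \<open>M R\<close> and \<open>M L R\<close>, for the
  letters \<open>L\<close> and \<open>R\<close>.  Only the four together are stable under prefixing a letter.
\<close>

lemma traces_palindromic:
  fixes w
  defines "k \<equiv> int (length w)"
  defines "p \<equiv> fst (col1 w)" and "r \<equiv> snd (col1 w)" and "q \<equiv> fst (col2 w)" and "s \<equiv> snd (col2 w)"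
  shows "p (k - i) + s (k - i) = p i + s i"
    and "p (k + 1 - i) + q (k - i) + s (k - i) = p i + q (i - 1) + s (i - 1)"
    and "p (k + 1 - i) + r (k + 1 - i) + s (k - i) = p i + r i + s (i - 1)"
    and "p (k + 2 - i) + r (k + 2 - i) + q (k + 1 - i) + s (k + 1 - i) + s (k - i) =
      p i + r i + q (i - 1) + s (i - 1) + s (i - 2)"
proof -
  have "(\<forall>i. p (k - i) + s (k - i) = p i + s i) \<and>
    (\<forall>i. p (k + 1 - i) + q (k - i) + s (k - i) = p i + q (i - 1) + s (i - 1)) \<and>
    (\<forall>i. p (k + 1 - i) + r (k + 1 - i) + s (k - i) = p i + r i + s (i - 1)) \<and>
    (\<forall>i. p (k + 2 - i) + r (k + 2 - i) + q (k + 1 - i) + s (k + 1 - i) + s (k - i) =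
      p i + r i + q (i - 1) + s (i - 1) + s (i - 2))"
    unfolding p_def q_def r_def s_def k_def
  proof (induction w)
    case Nil
    then show ?case by (auto simp: col1_simps col2_simps unit_seq_def)
  next
    case (Cons x w)
    define p r q s k where defs: "p = fst (col1 w)" "r = snd (col1 w)" "q = fst (col2 w)" "s = snd (col2 w)"
      "k = int (length w)"
    have I: "p (k - i) + s (k - i) = p i + s i"
      and L: "p (k + 1 - i) + q (k - i) + s (k - i) = p i + q (i - 1) + s (i - 1)"
      and R: "p (k + 1 - i) + r (k + 1 - i) + s (k - i) = p i + r i + s (i - 1)"
      and LR: "p (k + 2 - i) + r (k + 2 - i) + q (k + 1 - i) + s (k + 1 - i) + s (k - i) =
        p i + r i + q (i - 1) + s (i - 1) + s (i - 2)" for i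
      using Cons.IH by (auto simp: defs)
    have len: "int (length (y # w)) = k + 1" for y :: bool by (simp add: defs)
    \<comment> \<open>By cyclicity of the trace and the relations L^2 = (1 + z) L - z, the same for
      R, and L R + R L = (1 + z) (L + R) - z, the traces for the longer word are combinations of the
      four for \<open>w\<close> with coefficients of degree at most 2 in z. Hence the instances at
      \<open>i - 1\<close> and \<open>i - 2\<close>.\<close>
    note shifts = I L R LR I[of "i - 1" for i] L[of "i - 1" for i] R[of "i - 1" for i]
      LR[of "i - 1" for i] I[of "i - 2" for i] L[of "i - 2" for i] R[of "i - 2" for i]
    show ?case
    proof (cases x)
      case True
      then have x: "x # w = True # w" by simp
      show ?thesis
        unfolding len x col1_simps col2_simps fst_conv snd_conv defs[symmetric]
        apply (intro conjI allI)
        subgoal for i using shifts[of i] by (simp add: algebra_simps)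
        subgoal for i using shifts[of i] by (simp add: algebra_simps)
        subgoal for i using shifts[of i] by (simp add: algebra_simps)
        subgoal for i using shifts[of i] by (simp add: algebra_simps)
        done
    next
      case False
      then have x: "x # w = False # w" by simp
      show ?thesis
        unfolding len x col1_simps col2_simps fst_conv snd_conv defs[symmetric]
        apply (intro conjI allI)
        subgoal for i using shifts[of i] by (simp add: algebra_simps)
        subgoal for i using shifts[of i] by (simp add: algebra_simps)
        subgoal for i using shifts[of i] by (simp add: algebra_simps)
        subgoal for i using shifts[of i] by (simp add: algebra_simps)
        done
    qed
  qed
  then show "p (k - i) + s (k - i) = p i + s i"
    and "p (k + 1 - i) + q (k - i) + s (k - i) = p i + q (i - 1) + s (i - 1)"
    and "p (k + 1 - i) + r (k + 1 - i) + s (k - i) = p i + r i + s (i - 1)"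
    and "p (k + 2 - i) + r (k + 2 - i) + q (k + 1 - i) + s (k + 1 - i) + s (k - i) =
      p i + r i + q (i - 1) + s (i - 1) + s (i - 2)"
    by blast+
qed

text \<open>
  The value \<open>c t\<close> decreases with the distance of \<open>t\<close> from \<open>\<theta> / 2\<close>, and ties are broken towards the same
  side throughout.
\<close>

definition interlaced :: "(int \<Rightarrow> int) \<Rightarrow> int \<Rightarrow> bool" where
  "interlaced c \<theta> \<longleftrightarrow>
     (\<forall>t u. t < u \<longrightarrow> (t + u < \<theta> \<longrightarrow> c t \<le> c u) \<and> (t + u > \<theta> \<longrightarrow> c u \<le> c t)) \<and>
     ((\<forall>t u. t < u \<longrightarrow> t + u = \<theta> \<longrightarrow> c t \<le> c u) \<or> (\<forall>t u. t < u \<longrightarrow> t + u = \<theta> \<longrightarrow> c u \<le> c t))"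

lemma interlaced_asc: "interlaced c \<theta> \<Longrightarrow> t < u \<Longrightarrow> t + u < \<theta> \<Longrightarrow> c t \<le> c u"
  and interlaced_desc: "interlaced c \<theta> \<Longrightarrow> t < u \<Longrightarrow> t + u > \<theta> \<Longrightarrow> c u \<le> c t"
  unfolding interlaced_def by blast+

text \<open>Off the centre the direction is prescribed, at the centre it is the tie rule. This makes
  a sequence usable on a given reflection even when its centre is unknown.\<close>

lemma interlaced_uniform:
  assumes "interlaced c \<theta>"
  shows "(\<forall>t u. t < u \<longrightarrow> t + u = \<sigma> \<longrightarrow> c t \<le> c u) \<or> (\<forall>t u. t < u \<longrightarrow> t + u = \<sigma> \<longrightarrow> c u \<le> c t)"
proof (cases \<sigma> \<theta> rule: linorder_cases)
  case less
  then show ?thesis using interlaced_asc[OF assms] by simp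
next
  case equal
  then show ?thesis using assms by (simp add: interlaced_def)
next
  case greater
  then show ?thesis using interlaced_desc[OF assms] by simp
qed

lemma interlaced_zero: "interlaced (\<lambda>t. 0) \<theta>"
  by (simp add: interlaced_def)

lemma interlaced_unit: "interlaced unit_seq 0"
  by (auto simp: interlaced_def unit_seq_def)

lemma interlaced_shift:
  assumes "interlaced c \<theta>"
  shows "interlaced (\<lambda>t. c (t - 1)) (\<theta> + 2)"
proof -
  have "(\<forall>t u. t < u \<longrightarrow> t + u = \<theta> + 2 \<longrightarrow> c (t - 1) \<le> c (u - 1)) \<or>
      (\<forall>t u. t < u \<longrightarrow> t + u = \<theta> + 2 \<longrightarrow> c (u - 1) \<le> c (t - 1))"
    using interlaced_uniform[OF assms, of \<theta>]
  proof
    assume *: "\<forall>t u. t < u \<longrightarrow> t + u = \<theta> \<longrightarrow> c t \<le> c u"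
    have "c (t - 1) \<le> c (u - 1)" if "t < u" "t + u = \<theta> + 2" for t u
      using *[rule_format, of "t - 1" "u - 1"] that by simp
    then show ?thesis by simp
  next
    assume *: "\<forall>t u. t < u \<longrightarrow> t + u = \<theta> \<longrightarrow> c u \<le> c t"
    have "c (u - 1) \<le> c (t - 1)" if "t < u" "t + u = \<theta> + 2" for t u
      using *[rule_format, of "t - 1" "u - 1"] that by simp
    then show ?thesis by simp
  qed
  moreover have "c (t - 1) \<le> c (u - 1)" if "t < u" "t + u < \<theta> + 2" for t u
    using interlaced_asc[OF assms, of "t - 1" "u - 1"] that by simp
  moreover have "c (u - 1) \<le> c (t - 1)" if "t < u" "t + u > \<theta> + 2" for t u
    using interlaced_desc[OF assms, of "t - 1" "u - 1"] that by simp
  ultimately show ?thesis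
    unfolding interlaced_def by simp
qed

text \<open>Two reflections whose sums of positions are m and m + 1, or m - 1 and m, compose to a
  translation by 1; the direction of the tie decides which two give monotonicity on both sides of m
  / 2. A pair straddling the middle is then handled by one reflection followed by
  monotonicity.\<close>

lemma interlaced_of_reflections:
  fixes c :: "int \<Rightarrow> int"
  assumes above: "\<And>t u. t < u \<Longrightarrow> t + u = m + 1 \<Longrightarrow> c u \<le> c t"
    and below: "\<And>t u. t < u \<Longrightarrow> t + u = m - 1 \<Longrightarrow> c t \<le> c u"
    and tie: "(\<forall>t u. t < u \<longrightarrow> t + u = m \<longrightarrow> c t \<le> c u) \<or> (\<forall>t u. t < u \<longrightarrow> t + u = m \<longrightarrow> c u \<le> c t)"
  shows "interlaced c m"
proof -
  have up_down: "(2 * t + 2 \<le> m \<longrightarrow> c t \<le> c (t + 1)) \<and> (m \<le> 2 * t \<longrightarrow> c (t + 1) \<le> c t)" for t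
    using tie
  proof
    assume top: "\<forall>t u. t < u \<longrightarrow> t + u = m \<longrightarrow> c t \<le> c u"
    show ?thesis
    proof (intro conjI impI)
      assume t: "2 * t + 2 \<le> m"
      have "c t \<le> c (m - t)" using top t by simp
      also have "\<dots> \<le> c (t + 1)" using above[of "t + 1" "m - t"] t by (cases "t + 1 = m - t") auto
      finally show "c t \<le> c (t + 1)" .
    next
      assume t: "m \<le> 2 * t"
      have "c (t + 1) \<le> c (m - t)" using above t by simp
      also have "\<dots> \<le> c t" using top[rule_format, of "m - t" t] t by (cases "m - t = t") auto
      finally show "c (t + 1) \<le> c t" .
    qed
  next
    assume bot: "\<forall>t u. t < u \<longrightarrow> t + u = m \<longrightarrow> c u \<le> c t"
    show ?thesis
    proof (intro conjI impI)
      assume t: "2 * t + 2 \<le> m"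
      have "c t \<le> c (m - 1 - t)" using below t by simp
      also have "\<dots> \<le> c (t + 1)"
        using bot[rule_format, of "t + 1" "m - 1 - t"] t by (cases "t + 1 = m - 1 - t") auto
      finally show "c t \<le> c (t + 1)" .
    next
      assume t: "m \<le> 2 * t"
      have "c (t + 1) \<le> c (m - 1 - t)" using bot t by simp
      also have "\<dots> \<le> c t" using below t by simp
      finally show "c (t + 1) \<le> c t" .
    qed
  qed
  have up: "c t \<le> c u" if "t \<le> u" "2 * u \<le> m" for t u
    using that
  proof (induction u rule: int_ge_induct)
    case (step u)
    then show ?case using up_down[of u] by force
  qed simp
  have down: "c u \<le> c t" if "t \<le> u" "m \<le> 2 * t" for t u
    using that
  proof (induction u rule: int_ge_induct)
    case (step u)
    then show ?case using up_down[of u] by force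
  qed simp
  have "c t \<le> c u" if "t < u" "t + u < m" for t u
  proof (cases "2 * u \<le> m")
    case False
    have "c t \<le> c (m - 1 - t)" using below that by simp
    also have "\<dots> \<le> c u" using down[of u "m - 1 - t"] that False by simp
    finally show ?thesis .
  qed (use up that in simp)
  moreover have "c u \<le> c t" if "t < u" "t + u > m" for t u
  proof (cases "m \<le> 2 * t")
    case False
    have "c u \<le> c (m + 1 - u)" using above that by simp
    also have "\<dots> \<le> c t" using up[of "m + 1 - u" t] that False by simp
    finally show ?thesis .
  qed (use down that in simp)
  ultimately show ?thesis using tie unfolding interlaced_def by blast
qed

section \<open>Unimodality of the column heights and of their small and large parts\<close>

definition total_seq :: "bool list \<Rightarrow> seq" where
  "total_seq w t = fst (column_counts w) t + snd (column_counts w) t"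

lemma total_eq: "total_seq w t = fst (col1 w) t + snd (col1 w) t + fst (col2 w) (t - 1) + snd (col2 w) (t - 1)"
  using column_counts_eq_cols[of w t] by (simp add: total_seq_def)

text \<open>Let p, q, r, s be the entries of the matrix M of the word, row by row, and T = p + r + z
  q + z s the total. Then T + z^2 s = tr (M L R), p + z T = tr (M R L) and T - z q = tr (M R), all
  palindromic. The middle one follows from R L = (1 + z) (L + R) - z - L R, which explains the six
  instances used.\<close>

lemma total_reflections:
  fixes w
  defines "k \<equiv> int (length w)"
  shows "total_seq w i + snd (col2 w) (i - 2) = total_seq w (k + 2 - i) + snd (col2 w) (k - i)"
    and "total_seq w i + fst (col1 w) (i + 1) = total_seq w (k - i) + fst (col1 w) (k + 1 - i)"
    and "total_seq w i + fst (col2 w) (k - i) = total_seq w (k + 1 - i) + fst (col2 w) (i - 1)"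
proof -
  note T = traces_palindromic[of w, folded k_def]
  show "total_seq w i + snd (col2 w) (i - 2) = total_seq w (k + 2 - i) + snd (col2 w) (k - i)"
    unfolding total_eq using T(4)[of i] by (simp add: algebra_simps)
  show "total_seq w i + fst (col1 w) (i + 1) = total_seq w (k - i) + fst (col1 w) (k + 1 - i)"
    unfolding total_eq
    using T(1)[of i] T(2)[of i] T(2)[of "i + 1"] T(3)[of i] T(3)[of "i + 1"] T(4)[of "i + 1"]
    by (simp add: algebra_simps)
  show "total_seq w i + fst (col2 w) (k - i) = total_seq w (k + 1 - i) + fst (col2 w) (i - 1)"
    unfolding total_eq using T(3)[of i] by (simp add: algebra_simps)
qed

lemma word_act_shift:
  "word_act w (\<lambda>t. f (t - 1), \<lambda>t. g (t - 1)) = (\<lambda>t. fst (word_act w (f, g)) (t - 1), \<lambda>t. snd (word_act w (f, g)) (t - 1))"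
proof (induction w)
  case (Cons x w)
  then show ?case by (cases x) (auto split: prod.splits)
qed simp

text \<open>Each letter has (1, z) as one of its columns, the first for \<open>True\<close> and the
  second for \<open>False\<close>; its other column is z or 1 times a unit vector.\<close>

lemma col_snoc:
  "col1 (w @ [True]) = column_counts w"
  "col1 (w @ [False]) = col1 w"
  "col2 (w @ [True]) = (\<lambda>t. fst (col2 w) (t - 1), \<lambda>t. snd (col2 w) (t - 1))"
  "col2 (w @ [False]) = column_counts w"
  by (simp_all add: col1_def col2_def column_counts_def word_act_append flip: word_act_shift[of w "\<lambda>t. 0"])

text \<open>The reflections of the total are controlled by single matrix entries of the same word.
  Deleting letters on the right expresses column sums through totals of strictly shorter words, and
  deleting letters on the left expresses entries through column sums; so strong induction on the
  length closes the circle.\<close>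

theorem interlaced_total: "interlaced (total_seq w) (int (length w) + 1)"
proof (induction "length w" arbitrary: w rule: less_induct)
  case less
  have IH: "interlaced (total_seq v) (int (length v) + 1)" if "length v < length w" for v
    using less that by blast
  \<comment> \<open>A final \<open>False\<close> leaves the first column alone, and a final
    \<open>True\<close> turns it into the counts of a shorter word.\<close>
  have C1: "\<exists>\<theta>\<le>int (length v). interlaced (\<lambda>t. fst (col1 v) t + snd (col1 v) t) \<theta>"
    if "length v \<le> length w" for v
    using that
  proof (induction v rule: rev_induct)
    case Nil
    show ?case using interlaced_unit by (auto simp: col1_simps)
  next
    case (snoc x v)
    show ?case
    proof (cases x)
      case True
      then show ?thesis using IH[of v] snoc.prems
        by (intro exI[of _ "int (length v) + 1"]) (simp add: col_snoc total_seq_def[abs_def])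
    next
      case False
      obtain \<theta> where "\<theta> \<le> int (length v)" "interlaced (\<lambda>t. fst (col1 v) t + snd (col1 v) t) \<theta>"
        using snoc by auto
      then show ?thesis using False by (intro exI[of _ \<theta>]) (simp add: col_snoc)
    qed
  qed
  have C2: "\<exists>\<theta>\<ge>int (length v). interlaced (\<lambda>t. fst (col2 v) t + snd (col2 v) t) \<theta>"
    if "length v \<le> length w" for v
    using that
  proof (induction v rule: rev_induct)
    case Nil
    show ?case using interlaced_unit by (auto simp: col2_simps)
  next
    case (snoc x v)
    show ?case
    proof (cases x)
      case True
      obtain \<theta> where "\<theta> \<ge> int (length v)" "interlaced (\<lambda>t. fst (col2 v) t + snd (col2 v) t) \<theta>"
        using snoc by auto
      then show ?thesis using True interlaced_shift
        by (intro exI[of _ "\<theta> + 2"]) (auto simp add: col_snoc)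
    next
      case False
      then show ?thesis using IH[of v] snoc.prems
        by (intro exI[of _ "int (length v) + 1"]) (simp add: col_snoc total_seq_def[abs_def])
    qed
  qed
  \<comment> \<open>An initial \<open>True\<close> keeps the upper entry, and an initial
    \<open>False\<close> replaces it by a column sum.\<close>
  have P: "\<exists>\<theta>\<le>int (length v). interlaced (fst (col1 v)) \<theta>" if "length v \<le> length w" for v
    using that
  proof (induction v)
    case Nil
    show ?case using interlaced_unit by (auto simp: col1_simps)
  next
    case (Cons x v)
    show ?case
    proof (cases x)
      case True
      obtain \<theta> where "\<theta> \<le> int (length v)" "interlaced (fst (col1 v)) \<theta>" using Cons by auto
      then show ?thesis using True by (intro exI[of _ \<theta>]) (simp add: col1_simps)
    next
      case False
      obtain \<theta> where "\<theta> \<le> int (length v)" "interlaced (\<lambda>t. fst (col1 v) t + snd (col1 v) t) \<theta>"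
        using C1[of v] Cons.prems by auto
      then show ?thesis using False by (intro exI[of _ \<theta>]) (simp add: col1_simps)
    qed
  qed
  have S: "\<exists>\<theta>\<ge>int (length v). interlaced (snd (col2 v)) \<theta>" if "length v \<le> length w" for v
    using that
  proof (induction v)
    case Nil
    show ?case using interlaced_unit by (auto simp: col2_simps)
  next
    case (Cons x v)
    show ?case
    proof (cases x)
      case True
      obtain \<theta> where "\<theta> \<ge> int (length v)" "interlaced (\<lambda>t. fst (col2 v) t + snd (col2 v) t) \<theta>"
        using C2[of v] Cons.prems by auto
      then show ?thesis using True interlaced_shift
        by (intro exI[of _ "\<theta> + 2"]) (auto simp: col2_simps)
    next
      case False
      obtain \<theta> where "\<theta> \<ge> int (length v)" "interlaced (snd (col2 v)) \<theta>" using Cons by auto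
      then show ?thesis using False interlaced_shift
        by (intro exI[of _ "\<theta> + 2"]) (auto simp: col2_simps)
    qed
  qed
  have Q: "\<exists>\<theta>. interlaced (fst (col2 v)) \<theta>" if "length v \<le> length w" for v
    using that
  proof (induction v)
    case Nil
    show ?case using interlaced_zero by (auto simp: col2_simps)
  next
    case (Cons x v)
    then show ?case using C2[of v] by (cases x) (auto simp: col2_simps)
  qed
  define k where "k = int (length w)"
  show ?case
    unfolding k_def[symmetric]
  proof (rule interlaced_of_reflections)
    fix t u :: int assume tu: "t < u" "t + u = k + 1 + 1"
    obtain \<theta> where "\<theta> \<ge> k" "interlaced (snd (col2 w)) \<theta>" using S[of w] by (auto simp: k_def)
    then have "snd (col2 w) (t - 2) \<le> snd (col2 w) (u - 2)"
      using interlaced_asc[of "snd (col2 w)" \<theta> "t - 2" "u - 2"] tu by simp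
    moreover have *: "k + 2 - t = u" "k - t = u - 2" using tu by auto
    ultimately show "total_seq w u \<le> total_seq w t"
      using total_reflections(1)[of w t, folded k_def, unfolded *] by simp
  next
    fix t u :: int assume tu: "t < u" "t + u = k + 1 - 1"
    obtain \<theta> where "\<theta> \<le> k" "interlaced (fst (col1 w)) \<theta>" using P[of w] by (auto simp: k_def)
    then have "fst (col1 w) (u + 1) \<le> fst (col1 w) (t + 1)"
      using interlaced_desc[of "fst (col1 w)" \<theta> "t + 1" "u + 1"] tu by simp
    moreover have *: "k - t = u" "k + 1 - t = u + 1" using tu by auto
    ultimately show "total_seq w t \<le> total_seq w u"
      using total_reflections(2)[of w t, folded k_def, unfolded *] by simp
  next
    \<comment> \<open>On the central reflection the total compares like \<open>fst (col2 w)\<close>.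
      A common direction is all that is asked for, so any centre of that entry serves.\<close>
    have *: "total_seq w t - total_seq w u = fst (col2 w) (t - 1) - fst (col2 w) (u - 1)" if "t + u = k + 1" for t u
    proof -
      have *: "k - t = u - 1" "k + 1 - t = u" using that by auto
      show ?thesis using total_reflections(3)[of w t, folded k_def, unfolded *] by simp
    qed
    obtain \<theta> where \<theta>: "interlaced (fst (col2 w)) \<theta>" using Q[of w] by auto
    show "(\<forall>t u. t < u \<longrightarrow> t + u = k + 1 \<longrightarrow> total_seq w t \<le> total_seq w u) \<or>
        (\<forall>t u. t < u \<longrightarrow> t + u = k + 1 \<longrightarrow> total_seq w u \<le> total_seq w t)"
      using interlaced_uniform[OF \<theta>, of "k - 1"]
    proof
      assume le: "\<forall>t u. t < u \<longrightarrow> t + u = k - 1 \<longrightarrow> fst (col2 w) t \<le> fst (col2 w) u"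
      have "total_seq w t \<le> total_seq w u" if "t < u" "t + u = k + 1" for t u
        using *[OF that(2)] le[rule_format, of "t - 1" "u - 1"] that by simp
      then show ?thesis by blast
    next
      assume le: "\<forall>t u. t < u \<longrightarrow> t + u = k - 1 \<longrightarrow> fst (col2 w) u \<le> fst (col2 w) t"
      have "total_seq w u \<le> total_seq w t" if "t < u" "t + u = k + 1" for t u
        using *[OF that(2)] le[rule_format, of "t - 1" "u - 1"] that by simp
      then show ?thesis by blast
    qed
  qed
qed

text \<open>A letter replaces one of the two sequences by the old total, possibly shifted, whose
  centre \<open>length w + 1\<close> then meets the new bound exactly. The margin of 1 on either
  side of the centre of the new total makes both comparisons hold on the central reflection
  too.\<close>

lemma interlaced_column_counts:
  "(\<exists>\<theta>\<le>int (length w). interlaced (fst (column_counts w)) \<theta>) \<and>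
   (\<exists>\<theta>\<ge>int (length w) + 2. interlaced (snd (column_counts w)) \<theta>)"
proof (induction w)
  case Nil
  show ?case using interlaced_unit interlaced_shift[OF interlaced_unit] by (auto simp: column_counts_simps)
next
  case (Cons x w)
  then obtain \<theta> \<theta>' where *: "\<theta> \<le> int (length w)" "interlaced (fst (column_counts w)) \<theta>"
    "\<theta>' \<ge> int (length w) + 2" "interlaced (snd (column_counts w)) \<theta>'" by auto
  have tot: "interlaced (\<lambda>t. fst (column_counts w) t + snd (column_counts w) t) (int (length w) + 1)"
    using interlaced_total[of w] by (simp add: total_seq_def[abs_def])
  show ?case
  proof (cases x)
    case True
    show ?thesis
    proof
      show "\<exists>\<theta>\<le>int (length (x # w)). interlaced (fst (column_counts (x # w))) \<theta>"
        using True *(1,2) by (intro exI[of _ \<theta>]) (simp add: column_counts_simps)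
      show "\<exists>\<theta>\<ge>int (length (x # w)) + 2. interlaced (snd (column_counts (x # w))) \<theta>"
        using True interlaced_shift[OF tot]
        by (intro exI[of _ "int (length w) + 1 + 2"]) (simp add: column_counts_simps)
    qed
  next
    case False
    show ?thesis
    proof
      show "\<exists>\<theta>\<le>int (length (x # w)). interlaced (fst (column_counts (x # w))) \<theta>"
        using False tot by (intro exI[of _ "int (length w) + 1"]) (simp add: column_counts_simps)
      show "\<exists>\<theta>\<ge>int (length (x # w)) + 2. interlaced (snd (column_counts (x # w))) \<theta>"
        using False *(3) interlaced_shift[OF *(4)]
        by (intro exI[of _ "\<theta>' + 2"]) (simp add: column_counts_simps)
    qed
  qed
qed

section \<open>Ranks of meanders\<close>

text \<open>The minimum is not normalised, so that a solution on a meander passes directly to the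
  contracted meander.\<close>

definition meander_rank :: "nat \<Rightarrow> nat \<Rightarrow> (nat \<Rightarrow> int) \<Rightarrow> bool" where
  "meander_rank a b r \<longleftrightarrow> (\<forall>(k, l)\<in>meander_edges a b. r k = r l + 1)"

lemma meander_rank_iff:
  "meander_rank a b r \<longleftrightarrow>
     (\<forall>i. 1 \<le> i \<longrightarrow> i < a + b + 1 - i \<longrightarrow> r i = r (a + b + 1 - i) + 1) \<and>
     (\<forall>i. 1 \<le> i \<longrightarrow> i < a + 1 - i \<longrightarrow> r (a + 1 - i) = r i + 1) \<and>
     (\<forall>i. 1 \<le> i \<longrightarrow> a + i < a + b + 1 - i \<longrightarrow> r (a + b + 1 - i) = r (a + i) + 1)"
  unfolding meander_rank_def meander_edges_def Let_def by blast

text \<open>Uniqueness up to a constant stands in for connectedness. A small vertex of maximal rank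
  and a large one of rank 0 ensure that each letter enlarges the range of ranks by exactly 1. Column
  \<open>t\<close> holds the rank \<open>int (length w) + 1 - t\<close>.\<close>

definition ranked_by :: "nat \<Rightarrow> nat \<Rightarrow> bool list \<Rightarrow> (nat \<Rightarrow> int) \<Rightarrow> bool" where
  "ranked_by a b w r \<longleftrightarrow>
     meander_rank a b r \<and>
     (\<forall>r'. meander_rank a b r' \<longrightarrow> (\<exists>c. \<forall>i\<in>{1..a + b}. r' i = r i + c)) \<and>
     (\<forall>i\<in>{1..a + b}. 0 \<le> r i \<and> r i \<le> int (length w) + 1) \<and>
     (\<exists>i\<in>{1..a}. r i = int (length w) + 1) \<and> (\<exists>i\<in>{a + 1..a + b}. r i = 0) \<and>
     (\<forall>t. int (card {i\<in>{1..a}. r i = int (length w) + 1 - t}) = fst (column_counts w) t) \<and>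
     (\<forall>t. int (card {i\<in>{a + 1..a + b}. r i = int (length w) + 1 - t}) = snd (column_counts w) t)"

lemma card_split:
  "card {i\<in>{1..a + b}. P i} = card {i\<in>{1..a}. P i} + card {i\<in>{a + 1..a + b}. P i}" for a b :: nat
proof -
  have "{i\<in>{1..a + b}. P i} = {i\<in>{1..a}. P i} \<union> {i\<in>{a + 1..a + b}. P i}" by auto
  then show ?thesis by (simp add: card_Un_disjoint disjoint_iff)
qed

lemma ranked_by_base: "ranked_by 1 1 [] (\<lambda>i. if i = 1 then 1 else 0)"
proof -
  have "{i\<in>{1..1::nat}. (if i = 1 then 1 else 0) = 1 - t} = (if t = (0::int) then {1} else {})" for t
    by auto
  moreover have "{i\<in>{1 + 1..1 + 1::nat}. (if i = 1 then 1 else 0) = 1 - t} = (if t = (1::int) then {2} else {})" for t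
    by auto
  moreover have "meander_rank 1 1 (\<lambda>i. if i = 1 then 1 else 0)"
    unfolding meander_rank_iff by auto
  moreover have "\<exists>c. \<forall>i\<in>{1..1 + 1::nat}. r' i = (if i = 1 then 1 else 0) + c"
    if "meander_rank 1 1 r'" for r' :: "nat \<Rightarrow> int"
  proof -
    have "r' 1 = r' 2 + 1" using that unfolding meander_rank_iff by (auto dest: spec[of _ 1] simp: numeral_2_eq_2)
    moreover have "i = 1 \<or> i = 2" if "i \<in> {1..1 + 1}" for i :: nat using that by auto
    ultimately show ?thesis by (intro exI[of _ "r' 2"]) force
  qed
  ultimately show ?thesis
    unfolding ranked_by_def column_counts_simps by (auto simp: unit_seq_def)
qed

text \<open>Contracting the edges from the small vertices i to their mirror images leaves the
  vertices above \<open>a\<close>, which form the meander of \<open>a\<close>, \<open>b\<close> read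
  backwards. The large vertices therefore inherit all old ranks, and small vertex i lies one above
  old vertex i. As the maximum rises by 1, small counts stay in place and large ones move by one
  column.\<close>

lemma ranked_by_True:
  assumes r: "ranked_by a b w r" and ab: "a \<ge> 1" "b \<ge> 1"
  shows "ranked_by a (a + b) (True # w) (\<lambda>i. if i \<le> a then r i + 1 else r (a + (a + b) + 1 - i))"
    (is "ranked_by _ _ _ ?r")
proof -
  define n where "n = a + (a + b)"
  define q where "q = ?r"
  define m where "m = int (length w) + 1"
  have edges: "meander_rank a b r"
    and unique: "\<And>r'. meander_rank a b r' \<Longrightarrow> \<exists>c. \<forall>i\<in>{1..a + b}. r' i = r i + c"
    and bound: "\<And>i. 1 \<le> i \<Longrightarrow> i \<le> a + b \<Longrightarrow> 0 \<le> r i \<and> r i \<le> m"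
    and top: "\<exists>i\<in>{1..a}. r i = m" and bot: "\<exists>i\<in>{a + 1..a + b}. r i = 0"
    and S: "\<And>t. int (card {i\<in>{1..a}. r i = m - t}) = fst (column_counts w) t"
    and G: "\<And>t. int (card {i\<in>{a + 1..a + b}. r i = m - t}) = snd (column_counts w) t"
    using r unfolding ranked_by_def m_def by auto
  have e1: "r i = r (a + b + 1 - i) + 1" if "1 \<le> i" "i < a + b + 1 - i" for i
    using edges that unfolding meander_rank_iff by blast
  have e2: "r (a + 1 - i) = r i + 1" if "1 \<le> i" "i < a + 1 - i" for i
    using edges that unfolding meander_rank_iff by blast
  have e3: "r (a + b + 1 - i) = r (a + i) + 1" if "1 \<le> i" "a + i < a + b + 1 - i" for i
    using edges that unfolding meander_rank_iff by blast
  have small: "q i = r i + 1" if "i \<le> a" for i using that by (simp add: q_def)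
  have big: "q i = r (n + 1 - i)" if "a < i" for i using that by (simp add: q_def n_def)
  have "meander_rank a (a + b) q"
    unfolding meander_rank_iff n_def[symmetric]
  proof (intro conjI allI impI)
    fix i assume i: "1 \<le> i" "i < n + 1 - i"
    show "q i = q (n + 1 - i) + 1"
    proof (cases "i \<le> a")
      case True
      then have "a < n + 1 - i" "n + 1 - (n + 1 - i) = i" using ab by (auto simp: n_def)
      then show ?thesis using small[OF True] big[of "n + 1 - i"] by simp
    next
      case False
      then have *: "a < n + 1 - i" "n + 1 - (n + 1 - i) = i" "a < i"
          "a + b + 1 - (i - a) = n + 1 - i" "a + (i - a) = i"
        using i by (auto simp: n_def)
      then have "r (n + 1 - i) = r i + 1"
        using e3[of "i - a"] i by simp
      then show ?thesis using * big[of i] big[of "n + 1 - i"] by simp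
    qed
  next
    fix i assume i: "1 \<le> i" "i < a + 1 - i"
    then show "q (a + 1 - i) = q i + 1"
      using e2[OF i] small[of i] small[of "a + 1 - i"] by simp
  next
    fix i assume i: "1 \<le> i" "a + i < n + 1 - i"
    have "n + 1 - (n + 1 - i) = i" "n + 1 - (a + i) = a + b + 1 - i" "i < a + b + 1 - i"
      using i by (auto simp: n_def)
    then show "q (n + 1 - i) = q (a + i) + 1"
      using e1[OF i(1)] big[of "n + 1 - i"] big[of "a + i"] i by simp
  qed
  moreover have "\<exists>c. \<forall>i\<in>{1..n}. r' i = q i + c" if r': "meander_rank a (a + b) r'" for r'
  proof -
    have f1: "r' i = r' (n + 1 - i) + 1" if "1 \<le> i" "i < n + 1 - i" for i
      using r' that unfolding meander_rank_iff n_def by blast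
    have f2: "r' (a + 1 - i) = r' i + 1" if "1 \<le> i" "i < a + 1 - i" for i
      using r' that unfolding meander_rank_iff by blast
    have f3: "r' (n + 1 - i) = r' (a + i) + 1" if "1 \<le> i" "a + i < n + 1 - i" for i
      using r' that unfolding meander_rank_iff n_def by blast
    have "meander_rank a b (\<lambda>i. r' (n + 1 - i))"
      unfolding meander_rank_iff
    proof (intro conjI allI impI)
      fix i assume i: "1 \<le> i" "i < a + b + 1 - i"
      then have "n + 1 - (a + b + 1 - i) = a + i" by (auto simp: n_def)
      then show "r' (n + 1 - i) = r' (n + 1 - (a + b + 1 - i)) + 1"
        using f3[of i] i by (simp add: n_def)
    next
      \<comment> \<open>This edge of the contracted meander is an arc between two small vertices,
        seen from their mirror images.\<close>
      fix i assume i: "1 \<le> i" "i < a + 1 - i"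
      then show "r' (n + 1 - (a + 1 - i)) = r' (n + 1 - i) + 1"
        using f1[of i] f1[of "a + 1 - i"] f2[of i] by (simp add: n_def)
    next
      fix i assume i: "1 \<le> i" "a + i < a + b + 1 - i"
      then have "n + 1 - (a + b + 1 - i) = a + i" by (auto simp: n_def)
      then show "r' (n + 1 - (a + b + 1 - i)) = r' (n + 1 - (a + i)) + 1"
        using f1[of "a + i"] i by (simp add: n_def)
    qed
    then obtain c where c: "\<And>i. 1 \<le> i \<Longrightarrow> i \<le> a + b \<Longrightarrow> r' (n + 1 - i) = r i + c"
      using unique[of "\<lambda>i. r' (n + 1 - i)"] by auto
    have "r' i = q i + c" if "i \<in> {1..n}" for i
    proof (cases "i \<le> a")
      case True
      then show ?thesis using f1[of i] c[of i] small[OF True] that ab by (simp add: n_def)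
    next
      case False
      then have "n + 1 - (n + 1 - i) = i" "1 \<le> n + 1 - i" "n + 1 - i \<le> a + b"
        using that by (auto simp: n_def)
      then show ?thesis using c[of "n + 1 - i"] big[of i] False by simp
    qed
    then show ?thesis by blast
  qed
  moreover have "0 \<le> q i \<and> q i \<le> m + 1" if "i \<in> {1..n}" for i
  proof (cases "i \<le> a")
    case True
    then show ?thesis using small[of i] bound[of i] that by simp
  next
    case False
    then have "1 \<le> n + 1 - i" "n + 1 - i \<le> a + b" using that by (auto simp: n_def)
    then show ?thesis using bound[of "n + 1 - i"] big[of i] False by simp
  qed
  moreover have "\<exists>i\<in>{1..a}. q i = m + 1"
    using top small by auto
  moreover have "\<exists>i\<in>{a + 1..n}. q i = 0"
  proof -
    obtain i where i: "i \<in> {a + 1..a + b}" "r i = 0" using bot by blast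
    then have "n + 1 - i \<in> {a + 1..n}" "n + 1 - (n + 1 - i) = i" by (auto simp: n_def)
    then show ?thesis using i big[of "n + 1 - i"] by (intro bexI[of _ "n + 1 - i"]) auto
  qed
  moreover have "int (card {i\<in>{1..a}. q i = m + 1 - t}) = fst (column_counts (True # w)) t" for t
  proof -
    have "{i\<in>{1..a}. q i = m + 1 - t} = {i\<in>{1..a}. r i = m - t}" using small by auto
    then show ?thesis using S by (simp add: column_counts_simps)
  qed
  moreover have "int (card {i\<in>{a + 1..n}. q i = m + 1 - t}) = snd (column_counts (True # w)) t" for t
  proof -
    have "bij_betw (\<lambda>i. n + 1 - i) {i\<in>{a + 1..n}. q i = m + 1 - t} {i\<in>{1..a + b}. r i = m - (t - 1)}"
    proof (rule bij_betw_byWitness[where f' = "\<lambda>i. n + 1 - i"])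
      show "(\<lambda>i. n + 1 - i) ` {i\<in>{a + 1..n}. q i = m + 1 - t} \<subseteq> {i\<in>{1..a + b}. r i = m - (t - 1)}"
        using big by (auto simp: n_def)
      show "(\<lambda>i. n + 1 - i) ` {i\<in>{1..a + b}. r i = m - (t - 1)} \<subseteq> {i\<in>{a + 1..n}. q i = m + 1 - t}"
      proof
        fix k assume "k \<in> (\<lambda>i. n + 1 - i) ` {i\<in>{1..a + b}. r i = m - (t - 1)}"
        then obtain i where i: "k = n + 1 - i" "1 \<le> i" "i \<le> a + b" "r i = m - (t - 1)" by auto
        then have "a < k" "k \<le> n" "n + 1 - k = i" by (auto simp: n_def)
        then show "k \<in> {i\<in>{a + 1..n}. q i = m + 1 - t}" using big[of k] i by simp
      qed
    qed (auto simp: n_def)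
    then have "card {i\<in>{a + 1..n}. q i = m + 1 - t} = card {i\<in>{1..a + b}. r i = m - (t - 1)}"
      by (rule bij_betw_same_card)
    then show ?thesis using S[of "t - 1"] G[of "t - 1"] card_split[where P = "\<lambda>i. r i = m - (t - 1)" and a = a and b = b]
      by (simp add: column_counts_simps)
  qed
  ultimately show ?thesis
    unfolding q_def[symmetric] unfolding ranked_by_def n_def[symmetric] by (simp add: m_def add.commute)
qed

text \<open>Here the edges from i to its mirror image with \<open>i \<le> b\<close> are contracted,
  onto their sources. The first \<open>a + b\<close> vertices form the old meander backwards with
  all ranks raised by 1, and each large vertex copies the old large vertex \<open>b\<close> places
  below it.\<close>

lemma ranked_by_False:
  assumes r: "ranked_by a b w r" and ab: "a \<ge> 1" "b \<ge> 1"
  shows "ranked_by (a + b) b (False # w) (\<lambda>i. if i \<le> a + b then r (a + b + 1 - i) + 1 else r (i - b))"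
    (is "ranked_by _ _ _ ?r")
proof -
  define n where "n = a + b + b"
  define q where "q = ?r"
  define m where "m = int (length w) + 1"
  have edges: "meander_rank a b r"
    and unique: "\<And>r'. meander_rank a b r' \<Longrightarrow> \<exists>c. \<forall>i\<in>{1..a + b}. r' i = r i + c"
    and bound: "\<And>i. 1 \<le> i \<Longrightarrow> i \<le> a + b \<Longrightarrow> 0 \<le> r i \<and> r i \<le> m"
    and top: "\<exists>i\<in>{1..a}. r i = m" and bot: "\<exists>i\<in>{a + 1..a + b}. r i = 0"
    and S: "\<And>t. int (card {i\<in>{1..a}. r i = m - t}) = fst (column_counts w) t"
    and G: "\<And>t. int (card {i\<in>{a + 1..a + b}. r i = m - t}) = snd (column_counts w) t"
    using r unfolding ranked_by_def m_def by auto
  have e1: "r i = r (a + b + 1 - i) + 1" if "1 \<le> i" "i < a + b + 1 - i" for i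
    using edges that unfolding meander_rank_iff by blast
  have e2: "r (a + 1 - i) = r i + 1" if "1 \<le> i" "i < a + 1 - i" for i
    using edges that unfolding meander_rank_iff by blast
  have e3: "r (a + b + 1 - i) = r (a + i) + 1" if "1 \<le> i" "a + i < a + b + 1 - i" for i
    using edges that unfolding meander_rank_iff by blast
  have small: "q i = r (a + b + 1 - i) + 1" if "i \<le> a + b" for i using that by (simp add: q_def)
  have big: "q i = r (i - b)" if "a + b < i" for i using that by (simp add: q_def)
  have "meander_rank (a + b) b q"
    unfolding meander_rank_iff n_def[symmetric]
  proof (intro conjI allI impI)
    fix i assume i: "1 \<le> i" "i < n + 1 - i"
    show "q i = q (n + 1 - i) + 1"
    proof (cases "i \<le> b")
      case True
      then have "i \<le> a + b" "a + b < n + 1 - i" "n + 1 - i - b = a + b + 1 - i" by (auto simp: n_def)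
      then show ?thesis using small[of i] big[of "n + 1 - i"] by simp
    next
      case False
      then have *: "i \<le> a + b" "n + 1 - i \<le> a + b" "a + b + 1 - (n + 1 - i) = i - b"
        "a + 1 - (i - b) = a + b + 1 - i" "1 \<le> i - b" "i - b < a + 1 - (i - b)"
        using i by (auto simp: n_def)
      have "r (a + b + 1 - i) = r (i - b) + 1"
        using e2[OF *(5,6)] unfolding *(4) .
      then show ?thesis using small[OF *(1)] small[OF *(2)] unfolding *(3) by simp
    qed
  next
    fix i assume i: "1 \<le> i" "i < a + b + 1 - i"
    then have "i \<le> a + b" "a + b + 1 - i \<le> a + b" "a + b + 1 - (a + b + 1 - i) = i" by auto
    then show "q (a + b + 1 - i) = q i + 1"
      using e1[OF i] small[of i] small[of "a + b + 1 - i"] by simp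
  next
    fix i assume i: "1 \<le> i" "a + b + i < n + 1 - i"
    then have "a + b < n + 1 - i" "n + 1 - i - b = a + b + 1 - i" "a + b + i - b = a + i"
      "a + i < a + b + 1 - i"
      by (auto simp: n_def)
    then show "q (n + 1 - i) = q (a + b + i) + 1"
      using e3[OF i(1)] big[of "n + 1 - i"] big[of "a + b + i"] i by simp
  qed
  moreover have "\<exists>c. \<forall>i\<in>{1..n}. r' i = q i + c" if r': "meander_rank (a + b) b r'" for r'
  proof -
    have f1: "r' i = r' (n + 1 - i) + 1" if "1 \<le> i" "i < n + 1 - i" for i
      using r' that unfolding meander_rank_iff n_def by blast
    have f2: "r' (a + b + 1 - i) = r' i + 1" if "1 \<le> i" "i < a + b + 1 - i" for i
      using r' that unfolding meander_rank_iff by blast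
    have f3: "r' (n + 1 - i) = r' (a + b + i) + 1" if "1 \<le> i" "a + b + i < n + 1 - i" for i
      using r' that unfolding meander_rank_iff n_def by blast
    have "meander_rank a b (\<lambda>i. r' (a + b + 1 - i))"
      unfolding meander_rank_iff
    proof (intro conjI allI impI)
      fix i assume i: "1 \<le> i" "i < a + b + 1 - i"
      then have "a + b + 1 - (a + b + 1 - i) = i" by auto
      then show "r' (a + b + 1 - i) = r' (a + b + 1 - (a + b + 1 - i)) + 1"
        using f2[OF i] by simp
    next
      fix i assume i: "1 \<le> i" "i < a + 1 - i"
      then have "a + b + 1 - (a + 1 - i) = b + i" "n + 1 - (b + i) = a + b + 1 - i" "b + i < n + 1 - (b + i)"
        by (auto simp: n_def)
      then show "r' (a + b + 1 - (a + 1 - i)) = r' (a + b + 1 - i) + 1"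
        using f1[of "b + i"] i by simp
    next
      fix i assume i: "1 \<le> i" "a + i < a + b + 1 - i"
      then have "a + b + 1 - (a + b + 1 - i) = i" "a + b + 1 - (a + i) = b + 1 - i"
        "n + 1 - (b + 1 - i) = a + b + i" "i < n + 1 - i" "1 \<le> b + 1 - i"
        "b + 1 - i < n + 1 - (b + 1 - i)" "a + b + i < n + 1 - i"
        by (auto simp: n_def)
      then show "r' (a + b + 1 - (a + b + 1 - i)) = r' (a + b + 1 - (a + i)) + 1"
        using f1[of i] f1[of "b + 1 - i"] f3[of i] i by simp
    qed
    then obtain c where c: "\<And>i. 1 \<le> i \<Longrightarrow> i \<le> a + b \<Longrightarrow> r' (a + b + 1 - i) = r i + c"
      using unique[of "\<lambda>i. r' (a + b + 1 - i)"] by auto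
    \<comment> \<open>The surviving vertices are ranked one higher in \<open>q\<close> than in
      \<open>r\<close>, which the constant has to absorb.\<close>
    have "r' i = q i + (c - 1)" if "i \<in> {1..n}" for i
    proof (cases "i \<le> a + b")
      case True
      then have "a + b + 1 - (a + b + 1 - i) = i" "1 \<le> a + b + 1 - i" "a + b + 1 - i \<le> a + b"
        using that by auto
      then show ?thesis using c[of "a + b + 1 - i"] small[OF True] by simp
    next
      case False
      define j where "j = n + 1 - i"
      have j: "1 \<le> j" "j < n + 1 - j" "n + 1 - j = i" "a + b + 1 - (i - b) = j" "1 \<le> i - b" "i - b \<le> a + b"
        using that False ab by (auto simp: n_def j_def)
      then show ?thesis using f1[of j] c[of "i - b"] big[of i] False by simp
    qed
    then show ?thesis by blast
  qed
  moreover have "0 \<le> q i \<and> q i \<le> m + 1" if "i \<in> {1..n}" for i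
  proof (cases "i \<le> a + b")
    case True
    then have "1 \<le> a + b + 1 - i" "a + b + 1 - i \<le> a + b" using that by auto
    then show ?thesis using small[OF True] bound[of "a + b + 1 - i"] by linarith
  next
    case False
    then have "1 \<le> i - b" "i - b \<le> a + b" using that ab by (auto simp: n_def)
    then show ?thesis using bound[of "i - b"] big[of i] False by simp
  qed
  moreover have "\<exists>i\<in>{1..a + b}. q i = m + 1"
  proof -
    obtain i where i: "i \<in> {1..a}" "r i = m" using top by blast
    then have "a + b + 1 - i \<in> {1..a + b}" "a + b + 1 - (a + b + 1 - i) = i" by auto
    then show ?thesis using i small[of "a + b + 1 - i"] by (intro bexI[of _ "a + b + 1 - i"]) auto
  qed
  moreover have "\<exists>i\<in>{a + b + 1..n}. q i = 0"
  proof -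
    obtain i where i: "i \<in> {a + 1..a + b}" "r i = 0" using bot by blast
    then have "i + b \<in> {a + b + 1..n}" by (auto simp: n_def)
    then show ?thesis using i big[of "i + b"] by (intro bexI[of _ "i + b"]) auto
  qed
  moreover have "int (card {i\<in>{1..a + b}. q i = m + 1 - t}) = fst (column_counts (False # w)) t" for t
  proof -
    have "bij_betw (\<lambda>i. a + b + 1 - i) {i\<in>{1..a + b}. q i = m + 1 - t} {i\<in>{1..a + b}. r i = m - t}"
    proof (rule bij_betw_byWitness[where f' = "\<lambda>i. a + b + 1 - i"])
      show "(\<lambda>i. a + b + 1 - i) ` {i\<in>{1..a + b}. q i = m + 1 - t} \<subseteq> {i\<in>{1..a + b}. r i = m - t}"
      proof
        fix k assume "k \<in> (\<lambda>i. a + b + 1 - i) ` {i\<in>{1..a + b}. q i = m + 1 - t}"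
        then obtain i where i: "k = a + b + 1 - i" "1 \<le> i" "i \<le> a + b" "q i = m + 1 - t" by auto
        then have "1 \<le> k" "k \<le> a + b" by auto
        then show "k \<in> {i\<in>{1..a + b}. r i = m - t}" using small[OF i(3)] i(1,4) by simp
      qed
      show "(\<lambda>i. a + b + 1 - i) ` {i\<in>{1..a + b}. r i = m - t} \<subseteq> {i\<in>{1..a + b}. q i = m + 1 - t}"
      proof
        fix k assume "k \<in> (\<lambda>i. a + b + 1 - i) ` {i\<in>{1..a + b}. r i = m - t}"
        then obtain i where i: "k = a + b + 1 - i" "1 \<le> i" "i \<le> a + b" "r i = m - t" by auto
        then have "1 \<le> k" "k \<le> a + b" "a + b + 1 - k = i" by auto
        then show "k \<in> {i\<in>{1..a + b}. q i = m + 1 - t}" using small[of k] i(4) by simp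
      qed
    qed auto
    then have "card {i\<in>{1..a + b}. q i = m + 1 - t} = card {i\<in>{1..a + b}. r i = m - t}"
      by (rule bij_betw_same_card)
    then show ?thesis using S[of t] G[of t] card_split[where P = "\<lambda>i. r i = m - t" and a = a and b = b]
      by (simp add: column_counts_simps)
  qed
  moreover have "int (card {i\<in>{a + b + 1..n}. q i = m + 1 - t}) = snd (column_counts (False # w)) t" for t
  proof -
    have "bij_betw (\<lambda>i. i - b) {i\<in>{a + b + 1..n}. q i = m + 1 - t} {i\<in>{a + 1..a + b}. r i = m - (t - 1)}"
      by (rule bij_betw_byWitness[where f' = "\<lambda>i. i + b"]) (auto simp: n_def big Suc_le_eq)
    then have "card {i\<in>{a + b + 1..n}. q i = m + 1 - t} = card {i\<in>{a + 1..a + b}. r i = m - (t - 1)}"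
      by (rule bij_betw_same_card)
    then show ?thesis using G[of "t - 1"] by (simp add: column_counts_simps)
  qed
  ultimately show ?thesis
    unfolding q_def[symmetric] unfolding ranked_by_def n_def[symmetric] by (simp add: m_def add.commute)
qed

theorem ranked_by_exists:
  assumes "coprime a b" "a \<ge> 1" "b \<ge> 1"
  shows "\<exists>w r. ranked_by a b w r"
  using assms
proof (induction "a + b" arbitrary: a b rule: less_induct)
  case less
  consider "a = b" | "a < b" | "b < a" by linarith
  then show ?case
  proof cases
    case 1
    then have "a = 1" "b = 1" using less.prems by auto
    then show ?thesis using ranked_by_base by blast
  next
    case 2
    then obtain d where d: "b = a + d" "d \<ge> 1" using less_imp_add_positive[OF 2] by auto
    then have "coprime a d" using less.prems(1) by (simp add: coprime_iff_gcd_eq_1)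
    then obtain w r where "ranked_by a d w r" using less.hyps[of a d] less.prems d by auto
    then show ?thesis using ranked_by_True less.prems d by blast
  next
    case 3
    then obtain d where d: "a = d + b" "d \<ge> 1" using less_imp_add_positive[OF 3] by (auto simp: add.commute)
    then have "coprime d b" using less.prems(1) by (simp add: coprime_iff_gcd_eq_1)
    then obtain w r where "ranked_by d b w r" using less.hyps[of d b] less.prems d by auto
    then show ?thesis using ranked_by_False less.prems d by blast
  qed
qed

section \<open>Colourings of the pyramid\<close>

lemma card_split_pred: "finite B \<Longrightarrow> card B = card {x\<in>B. R x} + card {x\<in>B. \<not> R x}"
  by (subst card_Un_disjoint[symmetric]) (auto intro: arg_cong[of _ _ card])

text \<open>Since all steps are 0 or 1, successive jumps reach the values 1, 2, 3, ... without gaps,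
  so bounding the value selects an initial segment of the jumps.\<close>

lemma card_increments_le:
  fixes f :: "nat \<Rightarrow> nat"
  assumes "f 0 = 0" and "\<And>h. f (Suc h) = f h \<or> f (Suc h) = Suc (f h)"
  shows "card {i\<in>{1..h}. f (i - 1) < f i \<and> f i \<le> k} = min k (f h)"
proof (induction h)
  case (Suc h)
  have "{i\<in>{1..Suc h}. f (i - 1) < f i \<and> f i \<le> k} = {i\<in>{1..h}. f (i - 1) < f i \<and> f i \<le> k} \<union>
      (if f h < f (Suc h) \<and> f (Suc h) \<le> k then {Suc h} else {})"
    by (auto simp: le_Suc_eq)
  then have "card {i\<in>{1..Suc h}. f (i - 1) < f i \<and> f i \<le> k} = card {i\<in>{1..h}. f (i - 1) < f i \<and> f i \<le> k} +
      (if f h < f (Suc h) \<and> f (Suc h) \<le> k then 1 else 0)"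
    by (simp add: card_insert_if)
  then show ?case using Suc assms(2)[of h] by auto
qed (use assms in simp)

text \<open>
  \<open>\<beta>\<close> is the least nondecreasing function with steps at most 1 that takes a value \<open>\<ge> g t\<close> at the
  height of each column \<open>t \<le> p\<close>.  The rows at which it jumps can carry the large entries of all
  columns at once: a prefix of them up to \<open>p\<close>, and all of them plus some further rows after \<open>p\<close>.
\<close>

lemma column_colouring_exists:
  fixes s g :: "nat \<Rightarrow> nat" and p m :: nat
  assumes up: "\<And>t. t < p \<Longrightarrow> g t \<le> g (Suc t)"
    and down: "\<And>t. p < t \<Longrightarrow> t < m \<Longrightarrow> s (Suc t) \<le> s t"
    and across: "\<And>t u. t \<le> p \<Longrightarrow> p < u \<Longrightarrow> u \<le> m \<Longrightarrow> s t + g t \<le> s u + g u \<Longrightarrow> g t \<le> g u"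
    and across': "\<And>t u. t \<le> p \<Longrightarrow> p < u \<Longrightarrow> u \<le> m \<Longrightarrow> s u + g u \<le> s t + g t \<Longrightarrow> s u \<le> s t"
  obtains big :: "nat \<Rightarrow> nat \<Rightarrow> bool" where
    "\<And>t. t \<le> m \<Longrightarrow> card {h\<in>{1..s t + g t}. big t h} = g t"
    "\<And>t h. t < m \<Longrightarrow> big t h \<Longrightarrow> big (Suc t) h"
proof -
  define c where "c t = s t + g t" for t
  \<comment> \<open>By truncated subtraction, the term of column \<open>t\<close> equals
    \<open>g t\<close> from height \<open>c t\<close> on, descends with slope 1 below it and stops
    at 0: the least function that suits this column alone.\<close>
  define \<beta> where "\<beta> h = Max ((\<lambda>t. g t - (c t - h)) ` {..p})" for h
  define \<gamma> where "\<gamma> h = h - \<beta> h" for h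
  have ge: "g t - (c t - h) \<le> \<beta> h" if "t \<le> p" for t h
    unfolding \<beta>_def using that by (intro Max_ge) auto
  have attained: "\<exists>t\<le>p. \<beta> h = g t - (c t - h)" for h
  proof -
    have "\<beta> h \<in> (\<lambda>t. g t - (c t - h)) ` {..p}" unfolding \<beta>_def by (intro Max_in) auto
    then show ?thesis by auto
  qed
  have \<beta>0: "\<beta> 0 = 0" using attained[of 0] by (auto simp: c_def)
  have \<beta>_Suc: "\<beta> (Suc h) = \<beta> h \<or> \<beta> (Suc h) = Suc (\<beta> h)" for h
  proof -
    obtain t where "t \<le> p" "\<beta> h = g t - (c t - h)" using attained by blast
    then have "\<beta> h \<le> \<beta> (Suc h)" using ge[of t "Suc h"] by simp
    moreover obtain t' where "t' \<le> p" "\<beta> (Suc h) = g t' - (c t' - Suc h)" using attained by blast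
    then have "\<beta> (Suc h) \<le> Suc (\<beta> h)" using ge[of t' h] by simp
    ultimately show ?thesis by linarith
  qed
  have \<beta>_le: "\<beta> h \<le> h" for h
  proof (induction h)
    case (Suc h)
    then show ?case using \<beta>_Suc[of h] by auto
  qed (simp add: \<beta>0)
  have \<gamma>0: "\<gamma> 0 = 0" by (simp add: \<gamma>_def)
  have \<gamma>_Suc: "\<gamma> (Suc h) = \<gamma> h \<or> \<gamma> (Suc h) = Suc (\<gamma> h)" for h
    using \<beta>_Suc[of h] \<beta>_le[of h] by (auto simp: \<gamma>_def)
  \<comment> \<open>Up to \<open>p\<close> the first \<open>g t\<close> jump rows are large. After
    \<open>p\<close> the first \<open>s t\<close> rows without a jump, which are the jumps of
    \<open>\<gamma>\<close>, are small and all other rows large.\<close>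
  define big where "big t h \<longleftrightarrow> (if t \<le> p then \<beta> (h - 1) < \<beta> h \<and> \<beta> h \<le> g t
    else \<not> (\<gamma> (h - 1) < \<gamma> h \<and> \<gamma> h \<le> s t))" for t h
  show thesis
  proof
    fix t assume t: "t \<le> m"
    show "card {h\<in>{1..s t + g t}. big t h} = g t"
    proof (cases "t \<le> p")
      case True
      have "card {h\<in>{1..c t}. big t h} = min (g t) (\<beta> (c t))"
        using True card_increments_le[of \<beta>, OF \<beta>0 \<beta>_Suc] by (simp add: big_def)
      then show ?thesis using ge[OF True, of "c t"] by (simp add: c_def)
    next
      case False
      \<comment> \<open>Minimality of \<open>\<beta>\<close> enters here: its value at this height
        is due to a single column \<open>t'\<close> on the left, so comparing that column with
        \<open>t\<close> suffices.\<close>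
      obtain t' where t': "t' \<le> p" "\<beta> (c t) = g t' - (c t' - c t)" using attained by blast
      have "\<beta> (c t) \<le> g t"
      proof (cases "c t' \<le> c t")
        case True
        then show ?thesis using across[of t' t] t' False t by (simp add: c_def)
      next
        case c: False
        then have "s t \<le> s t'" using across'[of t' t] t' False t by (simp add: c_def)
        then show ?thesis using t' c by (simp add: c_def)
      qed
      then have "s t \<le> \<gamma> (c t)" by (simp add: \<gamma>_def c_def)
      then have small: "card {h\<in>{1..c t}. \<not> big t h} = s t"
        using False card_increments_le[of \<gamma>, OF \<gamma>0 \<gamma>_Suc, of "c t" "s t"] by (simp add: big_def)
      have "card {1..c t} = card {h\<in>{1..c t}. big t h} + card {h\<in>{1..c t}. \<not> big t h}"
        by (rule card_split_pred) simp
      then show ?thesis using small by (simp add: c_def)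
    qed
  next
    fix t h assume t: "t < m" and b: "big t h"
    consider "t < p" | "t = p" | "p < t" by linarith
    then show "big (Suc t) h"
    proof cases
      case 1
      then show ?thesis using b up[of t] by (simp add: big_def)
    next
      case 2
      then show ?thesis using b \<beta>_le[of h] by (auto simp: big_def \<gamma>_def)
    next
      case 3
      then show ?thesis using b down[of t] t by (auto simp: big_def)
    qed
  qed
qed

lemma coloured_enumeration:
  assumes "finite A" "card A = n" and "card {x\<in>A. P x} = card {h\<in>{1..n}. Q h}"
  obtains \<phi> where "bij_betw \<phi> {1..n} A" "\<And>h. h \<in> {1..n} \<Longrightarrow> P (\<phi> h) \<longleftrightarrow> Q h"
proof -
  have "card {x\<in>A. P x} + card {x\<in>A. \<not> P x} = card {h\<in>{1..n}. Q h} + card {h\<in>{1..n}. \<not> Q h}"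
    using card_split_pred[of A P] card_split_pred[of "{1..n}" Q] assms by simp
  then have "card {h\<in>{1..n}. \<not> Q h} = card {x\<in>A. \<not> P x}" using assms by simp
  then obtain \<phi>2 where 2: "bij_betw \<phi>2 {h\<in>{1..n}. \<not> Q h} {x\<in>A. \<not> P x}"
    using finite_same_card_bij[of "{h\<in>{1..n}. \<not> Q h}" "{x\<in>A. \<not> P x}"] assms(1) by auto
  obtain \<phi>1 where 1: "bij_betw \<phi>1 {h\<in>{1..n}. Q h} {x\<in>A. P x}"
    using finite_same_card_bij[of "{h\<in>{1..n}. Q h}" "{x\<in>A. P x}"] assms by auto
  define \<phi> where "\<phi> h = (if h \<in> {h\<in>{1..n}. Q h} then \<phi>1 h else \<phi>2 h)" for h
  have "bij_betw \<phi> ({h\<in>{1..n}. Q h} \<union> {h\<in>{1..n}. \<not> Q h}) ({x\<in>A. P x} \<union> {x\<in>A. \<not> P x})"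
    unfolding \<phi>_def by (rule bij_betw_disjoint_Un[OF 1 2]) auto
  moreover have "{h\<in>{1..n}. Q h} \<union> {h\<in>{1..n}. \<not> Q h} = {1..n}" "{x\<in>A. P x} \<union> {x\<in>A. \<not> P x} = A"
    by auto
  ultimately have "bij_betw \<phi> {1..n} A" by simp
  moreover have "P (\<phi> h) \<longleftrightarrow> Q h" if "h \<in> {1..n}" for h
    using bij_betwE[OF 1] bij_betwE[OF 2] that by (auto simp: \<phi>_def)
  ultimately show thesis by (rule that)
qed

section \<open>From ranks to fillings and good elements\<close>

lemma rank_function_unique:
  assumes r: "ranked_by a b w r" and ab: "a \<ge> 1"
  shows "is_rank_function a b (restrict r {1..a + b})"
    and "is_rank_function a b r' \<Longrightarrow> r' = restrict r {1..a + b}"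
proof -
  define n where "n = a + b"
  have n: "n \<ge> 1" using ab by (simp add: n_def)
  have edges: "\<And>k l. (k, l) \<in> meander_edges a b \<Longrightarrow> r k = r l + 1"
    and unique: "\<And>r'. meander_rank a b r' \<Longrightarrow> \<exists>c. \<forall>i\<in>{1..n}. r' i = r i + c"
    and bound: "\<And>i. i \<in> {1..n} \<Longrightarrow> 0 \<le> r i"
    and bot: "\<exists>i\<in>{a + 1..n}. r i = 0"
    using r unfolding ranked_by_def meander_rank_def n_def by auto
  obtain j where "j \<in> {a + 1..n}" "r j = 0" using bot by blast
  then have j: "j \<in> {1..n}" "r j = 0" by auto
  have vertices: "k \<in> {1..n}" "l \<in> {1..n}" if "(k, l) \<in> meander_edges a b" for k l
    using that unfolding meander_edges_def Let_def n_def by auto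
  have "Min (restrict r {1..n} ` {1..n}) = 0"
    using j bound by (intro Min_eqI) auto
  then show "is_rank_function a b (restrict r {1..a + b})"
    unfolding is_rank_function_def n_def[symmetric] using edges vertices by auto
  show "r' = restrict r {1..a + b}" if r': "is_rank_function a b r'"
  proof -
    have "meander_rank a b r'" using r' by (simp add: is_rank_function_def meander_rank_def)
    then obtain c where c: "\<And>i. i \<in> {1..n} \<Longrightarrow> r' i = r i + c" using unique by blast
    have min: "Min (r' ` {1..n}) = 0" using r' by (simp add: is_rank_function_def n_def)
    have "Min (r' ` {1..n}) \<le> r' j" using j(1) by (intro Min_le) auto
    then have "0 \<le> r' j" using min by simp
    moreover have "Min (r' ` {1..n}) \<in> r' ` {1..n}" using n by (intro Min_in) auto
    then obtain i where "i \<in> {1..n}" "r' i = 0" using min by auto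
    ultimately have "c = 0" using c[of i] c[of j] j bound[of i] by simp
    moreover have "r' \<in> extensional {1..n}" using r' by (simp add: is_rank_function_def n_def PiE_def)
    ultimately show ?thesis
      using c by (intro extensionalityI[of _ "{1..n}"]) (auto simp: n_def)
  qed
qed

lemma
  assumes r: "ranked_by a b w r" and ab: "a \<ge> 1"
  shows rnk_eq: "i \<in> {1..a + b} \<Longrightarrow> rnk a b i = r i"
    and max_rnk_eq: "max_rnk a b = length w + 1"
proof -
  have "rnk a b = restrict r {1..a + b}"
    unfolding rnk_def using rank_function_unique[OF assms] by blast
  then show rnk: "rnk a b i = r i" if "i \<in> {1..a + b}" for i
    using that by simp
  obtain j where "j \<in> {1..a}" "r j = int (length w) + 1"
    using r unfolding ranked_by_def by blast
  then have "j \<in> {1..a + b}" "r j = int (length w) + 1" by auto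
  moreover have "r i \<le> int (length w) + 1" if "i \<in> {1..a + b}" for i
    using r that unfolding ranked_by_def by auto
  ultimately have "Max (rnk a b ` {1..a + b}) = int (length w) + 1"
    using rnk by (intro Max_eqI) (auto intro!: image_eqI[of _ _ j])
  then show "max_rnk a b = length w + 1"
    by (simp add: max_rnk_def)
qed

lemma column_colouring:
  assumes r: "ranked_by a b w r" and ab: "a \<ge> 1"
  obtains big :: "nat \<Rightarrow> nat \<Rightarrow> bool" where
    "\<And>t. t \<le> max_rnk a b \<Longrightarrow>
      card {h\<in>{1..column_height a b t}. big t h} = card {i\<in>column_entries a b t. a < i}"
    "\<And>t h. t < max_rnk a b \<Longrightarrow> big t h \<Longrightarrow> big (Suc t) h"
proof -
  define m where "m = length w + 1"
  have m: "max_rnk a b = m" using max_rnk_eq[OF assms] by (simp add: m_def)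
  define s where "s t = card {i\<in>{1..a}. r i = int m - int t}" for t
  define g where "g t = card {i\<in>{a + 1..a + b}. r i = int m - int t}" for t
  have s: "int (s t) = fst (column_counts w) (int t)" and g: "int (g t) = snd (column_counts w) (int t)" for t
    using r unfolding ranked_by_def s_def g_def m_def by (auto simp: algebra_simps)
  have entries: "column_entries a b t = {i\<in>{1..a + b}. r i = int m - int t}" for t
    using rnk_eq[OF assms] by (auto simp: column_entries_def m)
  have height: "column_height a b t = s t + g t" for t
    unfolding column_height_def entries s_def g_def by (rule card_split)
  have "{i\<in>column_entries a b t. a < i} = {i\<in>{a + 1..a + b}. r i = int m - int t}" for t
    by (auto simp: entries)
  then have bigs: "card {i\<in>column_entries a b t. a < i} = g t" for t
    by (simp add: g_def)
  obtain \<theta> \<theta>' where \<theta>: "\<theta> \<le> int (length w)" "interlaced (fst (column_counts w)) \<theta>"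
    and \<theta>': "\<theta>' \<ge> int (length w) + 2" "interlaced (snd (column_counts w)) \<theta>'"
    using interlaced_column_counts[of w] by auto
  have s_desc: "s u \<le> s t" if "t < u" "m \<le> t + u" for t u
    using interlaced_desc[OF \<theta>(2), of "int t" "int u"] that \<theta>(1) s[of t] s[of u] by (simp add: m_def)
  have g_asc: "g t \<le> g u" if "t < u" "t + u \<le> m" for t u
    using interlaced_asc[OF \<theta>'(2), of "int t" "int u"] that \<theta>'(1) g[of t] g[of u] by (simp add: m_def)
  have c_asc: "s t + g t \<le> s u + g u" if "t < u" "t + u < m" for t u
    using interlaced_asc[OF interlaced_total, of "int t" "int u" w] that s[of t] s[of u] g[of t] g[of u]
    by (simp add: m_def total_seq_def)
  have c_desc: "s u + g u \<le> s t + g t" if "t < u" "m < t + u" for t u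
    using interlaced_desc[OF interlaced_total, of "int t" "int u" w] that s[of t] s[of u] g[of t] g[of u]
    by (simp add: m_def total_seq_def)
  obtain big where "\<And>t. t \<le> m \<Longrightarrow> card {h\<in>{1..s t + g t}. big t h} = g t"
    "\<And>t h. t < m \<Longrightarrow> big t h \<Longrightarrow> big (Suc t) h"
  \<comment> \<open>Splitting at the middle puts the sum of neighbouring positions on the side where
    \<open>g_asc\<close>, respectively \<open>s_desc\<close>, applies.\<close>
  proof (rule column_colouring_exists[of "m div 2" g m s])
    fix t assume "t < m div 2"
    then show "g t \<le> g (Suc t)" using g_asc[of t "Suc t"] by linarith
  next
    fix t assume "m div 2 < t" "t < m"
    then show "s (Suc t) \<le> s t" using s_desc[of t "Suc t"] by linarith
  next
    fix t u assume *: "t \<le> m div 2" "m div 2 < u" "u \<le> m" "s t + g t \<le> s u + g u"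
    then have "t < u" by simp
    show "g t \<le> g u"
    proof (cases "t + u \<le> m")
      case True
      then show ?thesis using g_asc \<open>t < u\<close> by simp
    next
      case False
      \<comment> \<open>Past the central reflection column \<open>u\<close> is not taller than
        \<open>t\<close>, so by assumption the heights agree, and fewer small entries mean more
        large ones.\<close>
      then show ?thesis using c_desc[of t u] s_desc[of t u] \<open>t < u\<close> * by simp
    qed
  next
    fix t u assume *: "t \<le> m div 2" "m div 2 < u" "u \<le> m" "s u + g u \<le> s t + g t"
    then have "t < u" by simp
    show "s u \<le> s t"
    proof (cases "m \<le> t + u")
      case True
      then show ?thesis using s_desc \<open>t < u\<close> by simp
    next
      case False
      then show ?thesis using c_asc[of t u] g_asc[of t u] \<open>t < u\<close> * by simp
    qed
  qed blast
  then show thesis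
    by (intro that[of big]) (simp_all add: m height bigs)
qed

text \<open>Consecutive entries of a row lie in different columns and are distinct, so the diagonal
  and with it the trace vanish. A nonzero entry in the lower left block would be a large entry
  followed by a small one.\<close>

lemma good_element_mem_parabolic:
  assumes f: "filling_respecting_ranks a b f"
    and no_descent: "\<And>i j. (i, j) \<in> consecutive_entries a b f \<Longrightarrow> a < i \<Longrightarrow> a < j"
  shows "good_element a b f \<in> maximal_parabolic a b"
proof -
  have bij: "bij_betw f (pyramid a b) {1..a + b}" using f by (simp add: filling_respecting_ranks_def)
  have entries: "1 \<le> i \<and> 1 \<le> j \<and> i \<noteq> j" if "(i, j) \<in> consecutive_entries a b f" for i j
  proof -
    obtain t h where *: "i = f (t, h)" "j = f (t + 1, h)" "(t, h) \<in> pyramid a b" "(t + 1, h) \<in> pyramid a b"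
      using \<open>(i, j) \<in> _\<close> by (auto simp: consecutive_entries_def)
    then have "i \<noteq> j" using bij inj_onD[of f "pyramid a b" "(t, h)" "(t + 1, h)"]
      by (auto simp: bij_betw_def)
    moreover have "i \<in> {1..a + b}" "j \<in> {1..a + b}" using * bij_betwE[OF bij] by auto
    ultimately show ?thesis by auto
  qed
  have zero: "good_element a b f $$ (k, l) = 0"
    if "k < a + b" "l < a + b" "k = l \<or> l < a \<and> a \<le> k" for k l
  proof -
    have "(case x of (i, j) \<Rightarrow> matrix_unit (a + b) i j $$ (k, l)) = 0" if x: "x \<in> consecutive_entries a b f" for x
    proof -
      obtain i j where ij: "x = (i, j)" by force
      have "\<not> (k = i - 1 \<and> l = j - 1)"
      proof
        assume kl: "k = i - 1 \<and> l = j - 1"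
        have "1 \<le> i" "1 \<le> j" "i \<noteq> j" using entries[of i j] x ij by auto
        then have "j \<le> a" "a < i" using kl \<open>k = l \<or> l < a \<and> a \<le> k\<close> by linarith+
        then show False using no_descent[of i j] x ij by simp
      qed
      then show ?thesis using that \<open>k < a + b\<close> \<open>l < a + b\<close> by (auto simp: ij matrix_unit_def)
    qed
    then show ?thesis using that(1,2) by (simp add: good_element_def sum.neutral)
  qed
  show ?thesis
    unfolding mem_maximal_parabolic using zero by (auto simp: good_element_def)
qed

theorem proposition14:
  fixes a b :: nat
  assumes "a \<ge> 1" and "b \<ge> 1"
    and "frobenius (a + b) (maximal_parabolic a b)"
  shows "\<exists>f. filling_respecting_ranks a b f \<and> good_element a b f \<in> maximal_parabolic a b"
proof -
  have "coprime a b" using coprime_of_frobenius assms by blast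
  then obtain w r where r: "ranked_by a b w r" using ranked_by_exists assms by blast
  let ?m = "max_rnk a b" and ?E = "column_entries a b" and ?c = "column_height a b"
  obtain big :: "nat \<Rightarrow> nat \<Rightarrow> bool" where
    big: "\<And>t. t \<le> ?m \<Longrightarrow> card {h\<in>{1..?c t}. big t h} = card {i\<in>?E t. a < i}"
    and big_Suc: "\<And>t h. t < ?m \<Longrightarrow> big t h \<Longrightarrow> big (Suc t) h"
    using column_colouring[OF r assms(1)] by blast
  \<comment> \<open>Once the colours of the boxes are fixed, the columns can be filled independently
    of one another.\<close>
  have "\<exists>\<phi>. t \<le> ?m \<longrightarrow> bij_betw \<phi> {1..?c t} (?E t) \<and> (\<forall>h\<in>{1..?c t}. a < \<phi> h \<longleftrightarrow> big t h)" for t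
  proof (cases "t \<le> ?m")
    case True
    have "finite (?E t)" by (simp add: column_entries_def)
    then show ?thesis
      using coloured_enumeration[of "?E t" "?c t" "\<lambda>i. a < i" "big t"] big[OF True]
      by (metis column_height_def)
  qed simp
  then obtain \<Phi> where \<Phi>: "\<And>t. t \<le> ?m \<Longrightarrow> bij_betw (\<Phi> t) {1..?c t} (?E t)"
    and colour: "\<And>t h. t \<le> ?m \<Longrightarrow> h \<in> {1..?c t} \<Longrightarrow> a < \<Phi> t h \<longleftrightarrow> big t h"
    by metis
  define f where "f = (\<lambda>(t, h). \<Phi> t h)"
  have mem: "f (t, h) \<in> ?E t" if "(t, h) \<in> pyramid a b" for t h
    using bij_betwE[OF \<Phi>[of t]] that by (auto simp: pyramid_def f_def)
  have inj: "inj_on f (pyramid a b)"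
  proof (rule inj_onI)
    fix x y assume xy: "x \<in> pyramid a b" "y \<in> pyramid a b" "f x = f y"
    obtain t h t' h' where [simp]: "x = (t, h)" "y = (t', h')" by force
    have "f x \<in> ?E t" "f x \<in> ?E t'" using mem[of t h] mem[of t' h'] xy by simp_all
    then have "t = t'" by (auto simp: column_entries_def)
    then show "x = y"
      using xy inj_onD[OF bij_betw_imp_inj_on[OF \<Phi>[of t]], of h h'] by (auto simp: pyramid_def f_def)
  qed
  have column: "f ` {(s, h) \<in> pyramid a b. s = t} = ?E t" if "t \<le> ?m" for t
  proof -
    have "{(s, h) \<in> pyramid a b. s = t} = Pair t ` {1..?c t}"
      using that by (auto simp: pyramid_def)
    then have "f ` {(s, h) \<in> pyramid a b. s = t} = \<Phi> t ` {1..?c t}"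
      by (simp add: image_image f_def)
    then show ?thesis using bij_betw_imp_surj_on[OF \<Phi>[OF that]] by simp
  qed
  have "f ` pyramid a b = {1..a + b}"
  proof
    show "f ` pyramid a b \<subseteq> {1..a + b}" using mem by (fastforce simp: column_entries_def)
  next
    show "{1..a + b} \<subseteq> f ` pyramid a b"
    proof
      fix i assume i: "i \<in> {1..a + b}"
      have "\<forall>i\<in>{1..a + b}. 0 \<le> r i \<and> r i \<le> int (length w) + 1"
        using r unfolding ranked_by_def by blast
      then have "0 \<le> r i \<and> r i \<le> int (length w) + 1" using i by blast
      then have ri: "0 \<le> r i" "r i \<le> int ?m"
        using max_rnk_eq[OF r assms(1)] by simp_all
      define t where "t = nat (int ?m - r i)"
      have t: "t \<le> ?m" "i \<in> ?E t"
        using ri i rnk_eq[OF r assms(1) i] by (auto simp: t_def column_entries_def)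
      then show "i \<in> f ` pyramid a b" using column[OF t(1)] by blast
    qed
  qed
  then have fill: "filling_respecting_ranks a b f"
    unfolding filling_respecting_ranks_def bij_betw_def using inj column by blast
  have "a < j" if ij: "(i, j) \<in> consecutive_entries a b f" "a < i" for i j
  proof -
    obtain t h where *: "i = f (t, h)" "j = f (t + 1, h)" "(t, h) \<in> pyramid a b" "(t + 1, h) \<in> pyramid a b"
      using ij(1) by (auto simp: consecutive_entries_def)
    then have "big t h" using colour[of t h] ij(2) by (auto simp: f_def pyramid_def)
    then have "big (t + 1) h" using big_Suc[of t h] *(4) by (simp add: pyramid_def)
    then show ?thesis using colour[of "t + 1" h] * by (auto simp: f_def pyramid_def)
  qed
  then show ?thesis using fill good_element_mem_parabolic by blast
qed

end
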